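(* Let $r,r'\ge 2$ be integers. There is a constant $c_{r,r'}>0$ depending only on $r,r'$ such that for every $M\ge2$, every $H\in\mathscr{H}_M^{r'}$ and every $\chi\in\mathscr{H}_M^r$, the Poisson bracket $\{\chi,H\}$ is a homogeneous polynomial of degree $r+r'-2$ (i.e. $\{\chi,H\}\in\mathscr{H}_M^{r+r'-2}$) and $$\|\{\chi,H\}\|_{\mathscr{H}}\le c_{r,r'}\,\log M\,\|H\|_{\mathscr{H}}\,\|\chi\|_{\mathscr{C}}.$$
   Context: $\mathbb{N}=\{0,1,2,\dots\}$, $\langle y\rangle=\sqrt{1+y^2}$. For $M\in(0,\infty)$, $\mathcal{T}_M=\{(\ell,m)\in\mathbb{N}\times\mathbb{Z}:0\le\ell\le M,\ -\ell\le m\le\ell\}$. $\mathbb{C}^{\mathcal{T}_M}$ is viewed as a real Euclidean space with $(u,v)_{\ell^2}=\Re\sum_{k\in\mathcal{T}_M}u_k\overline{v_k}$; $\nabla$ is the gradient for this scalar product; the Poisson bracket is $\{H,K\}(u)=(i\nabla H(u),\nabla K(u))_{\ell^2}$. $\mathscr{H}_M^q$ ($q\ge2$) is the space of real-valued homogeneous polynomials of degree $q$ on the real vector space $\mathbb{C}^{\mathcal{T}_M}$ (the zero polynomial included). Each $P\in\mathscr{H}_M^q$ is uniquely written $P(u)=\sum_{\sigma\in\{-1,1\}^q}\sum_{\mathbf{k}\in\mathcal{T}_M^q}P_{\mathbf{k}}^\sigma u_{k_1}^{\sigma_1}\cdots u_{k_q}^{\sigma_q}$ (with $u_k^{1}=u_k$,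 $u_k^{-1}=\overline{u_k}$), where the complex coefficients satisfy $P_{\mathbf{k}}^{-\sigma}=\overline{P_{\mathbf{k}}^\sigma}$ and are invariant under simultaneous permutation of the entries of $\mathbf{k}$ and $\sigma$. With $k_j=(\ell_j,m_j)$ and $\Upsilon(\mathbf{k})=\max(\{1\}\cup\{\langle\ell_j\rangle:1\le j\le q,\ \forall j'\ne j,\ k_{j'}\ne k_j\})$, $$\|P\|_{\mathscr{H}}=\max_{\sigma,\mathbf{k}}|P_{\mathbf{k}}^\sigma|\sqrt{\langle\ell_1\rangle\cdots\langle\ell_q\rangle}\sqrt{\Upsilon(\mathbf{k})},$$ $$\|P\|_{\mathscr{C}}=\max_{\sigma,\mathbf{k}}|P_{\mathbf{k}}^\sigma|\,\langle\sigma_1\ell_1+\cdots+\sigma_q\ell_q\rangle\sqrt{\langle\ell_1\rangle\cdots\langle\ell_q\rangle}\sqrt{\Upsilon(\mathbf{k})},$$ the maxima being over $\sigma\in\{-1,1\}^q$ and $\mathbf{k}\in\mathcal{T}_M^q$. *)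

theory Defs
  imports Complex_Main "HOL-Combinatorics.List_Permutation"
begin

definition jap :: "real \<Rightarrow> real" where
  "jap y = sqrt (1 + y\<^sup>2)"

type_synonym idx = "nat \<times> int"

definition modes :: "real \<Rightarrow> idx set" where
  "modes M = {(l, m). real l \<le> M \<and> - int l \<le> m \<and> m \<le> int l}"

text \<open>
  Since the truncation parameter is quantified inside the theorem, the space of complex families
  indexed by \<^term>\<open>modes M\<close> is represented as the set of functions vanishing off \<^term>\<open>modes M\<close>.
  A function on this space is an HOL function on all families; only its values on
  \<^term>\<open>states M\<close> are ever used.
\<close>

definition states :: "real \<Rightarrow> (idx \<Rightarrow> complex) set" where
  "states M = {u. \<forall>k. k \<notin> modes M \<longrightarrow> u k = 0}"

definition l2_inner :: "real \<Rightarrow> (idx \<Rightarrow> complex) \<Rightarrow> (idx \<Rightarrow> complex) \<Rightarrow> real" where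
  "l2_inner M u v = Re (\<Sum>k\<in>modes M. u k * cnj (v k))"

definition l2_norm :: "real \<Rightarrow> (idx \<Rightarrow> complex) \<Rightarrow> real" where
  "l2_norm M u = sqrt (l2_inner M u u)"

text \<open>
  Function types carry no norm in the library, so Frechet differentiability on the
  finite-dimensional Euclidean space \<^term>\<open>states M\<close> is written out.
\<close>

definition has_gradient ::
  "real \<Rightarrow> ((idx \<Rightarrow> complex) \<Rightarrow> real) \<Rightarrow> (idx \<Rightarrow> complex) \<Rightarrow> (idx \<Rightarrow> complex) \<Rightarrow> bool" where
  "has_gradient M P u v \<longleftrightarrow> v \<in> states M \<and>
     (\<forall>e>0. \<exists>d>0. \<forall>h\<in>states M. l2_norm M h < d \<longrightarrow>
        \<bar>P (\<lambda>k. u k + h k) - P u - l2_inner M v h\<bar> \<le> e * l2_norm M h)"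

definition gradient ::
  "real \<Rightarrow> ((idx \<Rightarrow> complex) \<Rightarrow> real) \<Rightarrow> (idx \<Rightarrow> complex) \<Rightarrow> (idx \<Rightarrow> complex)" where
  "gradient M P u = (THE v. has_gradient M P u v)"

definition poisson_bracket ::
  "real \<Rightarrow> ((idx \<Rightarrow> complex) \<Rightarrow> real) \<Rightarrow> ((idx \<Rightarrow> complex) \<Rightarrow> real) \<Rightarrow> (idx \<Rightarrow> complex) \<Rightarrow> real" where
  "poisson_bracket M H K u = l2_inner M (\<lambda>k. \<i> * gradient M H u k) (gradient M K u)"

text \<open>
  Real coordinates: \<^term>\<open>(k, True)\<close> and \<^term>\<open>(k, False)\<close> index the real and the imaginary part
  of the component at \<^term>\<open>k\<close>. A monomial of degree \<^term>\<open>q\<close> is a list of \<^term>\<open>q\<close> coordinates.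
\<close>

definition real_coord :: "(idx \<Rightarrow> complex) \<Rightarrow> idx \<times> bool \<Rightarrow> real" where
  "real_coord u x = (if snd x then Re (u (fst x)) else Im (u (fst x)))"

definition homogeneous_polys :: "real \<Rightarrow> nat \<Rightarrow> ((idx \<Rightarrow> complex) \<Rightarrow> real) set" where
  "homogeneous_polys M q = {P. \<exists>a :: (idx \<times> bool) list \<Rightarrow> real. \<forall>u\<in>states M.
     P u = (\<Sum>xs | set xs \<subseteq> modes M \<times> UNIV \<and> length xs = q. a xs * (\<Prod>j<q. real_coord u (xs ! j)))}"

definition sign_tuples :: "nat \<Rightarrow> int list set" where
  "sign_tuples q = {\<sigma>. set \<sigma> \<subseteq> {-1, 1} \<and> length \<sigma> = q}"

definition mode_tuples :: "real \<Rightarrow> nat \<Rightarrow> idx list set" where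
  "mode_tuples M q = {k. set k \<subseteq> modes M \<and> length k = q}"

definition sign_conj :: "int \<Rightarrow> complex \<Rightarrow> complex" where
  "sign_conj s z = (if s = 1 then z else cnj z)"

text \<open>
  The first condition only pins down the values outside the meaningful range, so that the
  coefficient family of a polynomial is unique as an HOL function.
\<close>

definition is_coeff_family ::
  "real \<Rightarrow> nat \<Rightarrow> ((idx \<Rightarrow> complex) \<Rightarrow> real) \<Rightarrow> (int list \<Rightarrow> idx list \<Rightarrow> complex) \<Rightarrow> bool" where
  "is_coeff_family M q P c \<longleftrightarrow>
     (\<forall>\<sigma> k. \<not> (\<sigma> \<in> sign_tuples q \<and> k \<in> mode_tuples M q) \<longrightarrow> c \<sigma> k = 0) \<and>
     (\<forall>\<sigma>\<in>sign_tuples q. \<forall>k\<in>mode_tuples M q. c (map uminus \<sigma>) k = cnj (c \<sigma> k)) \<and>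
     (\<forall>\<sigma>\<in>sign_tuples q. \<forall>k\<in>mode_tuples M q. \<forall>p. p permutes {..<q} \<longrightarrow>
        c (permute_list p \<sigma>) (permute_list p k) = c \<sigma> k) \<and>
     (\<forall>u\<in>states M. complex_of_real (P u) =
        (\<Sum>\<sigma>\<in>sign_tuples q. \<Sum>k\<in>mode_tuples M q. c \<sigma> k * (\<Prod>j<q. sign_conj (\<sigma> ! j) (u (k ! j)))))"

definition poly_coeff ::
  "real \<Rightarrow> nat \<Rightarrow> ((idx \<Rightarrow> complex) \<Rightarrow> real) \<Rightarrow> int list \<Rightarrow> idx list \<Rightarrow> complex" where
  "poly_coeff M q P = (THE c. is_coeff_family M q P c)"

definition Upsilon :: "idx list \<Rightarrow> real" where
  "Upsilon k = Max ({1} \<union> {jap (real (fst (k ! j))) | j.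
     j < length k \<and> (\<forall>j'<length k. j' \<noteq> j \<longrightarrow> k ! j' \<noteq> k ! j)})"

definition norm_H :: "real \<Rightarrow> nat \<Rightarrow> ((idx \<Rightarrow> complex) \<Rightarrow> real) \<Rightarrow> real" where
  "norm_H M q P = (MAX (\<sigma>, k) \<in> sign_tuples q \<times> mode_tuples M q.
     cmod (poly_coeff M q P \<sigma> k) * sqrt (\<Prod>j<q. jap (real (fst (k ! j)))) * sqrt (Upsilon k))"

definition norm_C :: "real \<Rightarrow> nat \<Rightarrow> ((idx \<Rightarrow> complex) \<Rightarrow> real) \<Rightarrow> real" where
  "norm_C M q P = (MAX (\<sigma>, k) \<in> sign_tuples q \<times> mode_tuples M q.
     cmod (poly_coeff M q P \<sigma> k) * jap (real_of_int (\<Sum>j<q. \<sigma> ! j * int (fst (k ! j)))) *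
     sqrt (\<Prod>j<q. jap (real (fst (k ! j)))) * sqrt (Upsilon k))"

end

theory Submission
  imports Defs "HOL-Combinatorics.Multiset_Permutations"
begin

text \<open>
  Write the polynomials as forms with symmetric coefficients in the coordinates \<open>u\<^sub>k\<close> and
  \<open>cnj u\<^sub>k\<close>. Since the gradient is twice the derivative with respect to
  \<open>cnj u\<^sub>k\<close>, the bracket \<open>{\<chi>, H}\<close> is the form whose coefficients are obtained by
  contracting one entry: up to the factor \<open>2 \<i> r r'\<close>, they are the sums over \<open>k\<close> and
  \<open>s = 1, -1\<close> of \<open>- s\<close> times the coefficient of \<open>\<chi>\<close> at \<open>(k, s) # xs\<close> and the
  coefficient of \<open>H\<close> at \<open>(k, - s) # ys\<close> (lemma \<open>poisson_bracket_form\<close>). The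
  coefficients that define the norm are the averages of these over rearrangements, so they obey the same
  bounds; that a symmetric family is determined by the polynomial is
  \<open>symmetric_coeffs_unique\<close>.

  For the estimate, let \<open>l\<close> be the degree of the contracted mode \<open>k\<close>, and write
  \<open>\<langle>x\<rangle>\<close> for \<open>jap x\<close>. The two norms give each term the factor
  \<open>1 / (\<langle>s l + p\<rangle> \<langle>l\<rangle>)\<close>, where \<open>p\<close> is the phase of \<open>xs\<close>: the bracket around \<open>l\<close> comes
  from the two square roots at the contracted entry and the other one from the norm of \<open>\<chi>\<close>. What has
  to be controlled is the weight \<open>Upsilon\<close>, which is not multiplicative. If \<open>k\<close> is
  different from all modes in \<open>xs\<close> and \<open>ys\<close>, then it is lone in (occurs exactly once in) both contracted lists, and
  \<open>Upsilon (xs @ ys) \<le> Upsilon (k # xs) * Upsilon (k # ys)\<close>. If \<open>k\<close> is among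
  these modes, one loses at most \<open>\<langle>l\<rangle>\<^sup>2\<close> on the right, that is \<open>\<langle>l\<rangle>\<close> after
  taking the square root, which the gain absorbs, and there are at most \<open>r + r' - 2\<close> such
  \<open>k\<close> (lemma \<open>bracket_term_le\<close>).

  Finally, each degree \<open>l\<close> carries \<open>2 l + 1 \<le> 3 \<langle>l\<rangle>\<close> modes, so the sum over the
  generic \<open>k\<close> is at most three times the sum of \<open>1 / \<langle>s l + p\<rangle>\<close> over \<open>l \<le> M\<close>. The numbers
  \<open>s l + p\<close> are distinct integers, so this is bounded by a constant times \<open>ln M\<close>, uniformly in
  \<open>p\<close> (lemma \<open>sum_modes_inverse_le\<close>).
\<close>

section \<open>Forms in finitely many commuting coordinates\<close>

definition tuples :: "'a set \<Rightarrow> nat \<Rightarrow> 'a list set" where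
  "tuples A q = {xs. set xs \<subseteq> A \<and> length xs = q}"

lemma tuples_0 [simp]: "tuples A 0 = {[]}"
  by (auto simp: tuples_def)

lemma finite_tuples [simp]: "finite A \<Longrightarrow> finite (tuples A q)"
  unfolding tuples_def by (rule finite_lists_length_eq)

lemma Cons_in_tuples_iff [simp]: "x # xs \<in> tuples A (Suc q) \<longleftrightarrow> x \<in> A \<and> xs \<in> tuples A q"
  by (auto simp: tuples_def)

lemma sum_tuples_Suc:
  "(\<Sum>xs\<in>tuples A (Suc q). f xs) = (\<Sum>x\<in>A. \<Sum>xs\<in>tuples A q. f (x # xs))"
proof -
  have "tuples A (Suc q) = (\<lambda>(x, xs). x # xs) ` (A \<times> tuples A q)"
    by (auto simp: tuples_def image_iff length_Suc_conv)
  moreover have "inj_on (\<lambda>(x, xs). x # xs) (A \<times> tuples A q)"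
    by (auto simp: inj_on_def)
  ultimately show ?thesis
    by (simp add: sum.reindex sum.cartesian_product case_prod_unfold)
qed

lemma sum_tuples_append:
  "(\<Sum>zs\<in>tuples A (p + q). f zs) = (\<Sum>xs\<in>tuples A p. \<Sum>ys\<in>tuples A q. f (xs @ ys))"
  by (induction p arbitrary: f) (simp_all add: sum_tuples_Suc)

definition form :: "'a set \<Rightarrow> nat \<Rightarrow> ('a list \<Rightarrow> complex) \<Rightarrow> ('a \<Rightarrow> complex) \<Rightarrow> complex" where
  "form A q c w = (\<Sum>xs\<in>tuples A q. c xs * prod_list (map w xs))"

lemma form_cong:
  assumes "\<And>xs. xs \<in> tuples A q \<Longrightarrow> c xs = c' xs" "\<And>x. x \<in> A \<Longrightarrow> w x = w' x"
  shows "form A q c w = form A q c' w'"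
  unfolding form_def
proof (rule sum.cong)
  fix xs assume xs: "xs \<in> tuples A q"
  then have "map w xs = map w' xs"
    using assms(2) by (auto simp: tuples_def)
  then show "c xs * prod_list (map w xs) = c' xs * prod_list (map w' xs)"
    using assms(1)[OF xs] by (simp only:)
qed simp

lemma form_Suc: "form A (Suc q) c w = (\<Sum>x\<in>A. w x * form A q (\<lambda>xs. c (x # xs)) w)"
  by (simp add: form_def sum_tuples_Suc sum_distrib_left algebra_simps)

lemma cnj_form: "cnj (form A q c w) = form A q (\<lambda>xs. cnj (c xs)) (\<lambda>x. cnj (w x))"
proof -
  have "cnj (prod_list (map w xs)) = prod_list (map (\<lambda>x. cnj (w x)) xs)" for xs
    by (induction xs) auto
  then show ?thesis by (simp add: form_def)
qed

lemma prod_list_sum_expand: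
  fixes g :: "'a \<Rightarrow> 'b \<Rightarrow> complex"
  shows "prod_list (map (\<lambda>x. \<Sum>y\<in>B. g x y) xs) =
    (\<Sum>ys\<in>tuples B (length xs). prod_list (map2 g xs ys))"
  by (induction xs) (simp_all add: sum_tuples_Suc sum_product)

text \<open>
  Substituting linear combinations of new coordinates into a homogeneous polynomial gives a
  homogeneous polynomial of the same degree. This is how one passes between real and imaginary
  parts on one side and \<open>u\<close> and its conjugate on the other.
\<close>

lemma form_linear_change:
  assumes "\<And>x. x \<in> A \<Longrightarrow> v x = (\<Sum>y\<in>B. \<alpha> x y * w y)"
  shows "form A q c v =
    form B q (\<lambda>ys. \<Sum>xs\<in>tuples A q. c xs * prod_list (map2 \<alpha> xs ys)) w"
proof -
  have prod_split: "prod_list (map2 (\<lambda>x y. \<alpha> x y * w y) xs ys) = prod_list (map2 \<alpha> xs ys) * prod_list (map w ys)"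
    if "length xs = length ys" for xs ys
    using that by (induction xs ys rule: list_induct2) auto
  have "form A q c v = form A q c (\<lambda>x. \<Sum>y\<in>B. \<alpha> x y * w y)"
    by (rule form_cong) (use assms in auto)
  also have "\<dots> = (\<Sum>xs\<in>tuples A q. \<Sum>ys\<in>tuples B q. c xs * prod_list (map2 \<alpha> xs ys) * prod_list (map w ys))"
    unfolding form_def
  proof (rule sum.cong)
    fix xs assume "xs \<in> tuples A q"
    then have len: "length xs = q" by (simp add: tuples_def)
    show "c xs * prod_list (map (\<lambda>x. \<Sum>y\<in>B. \<alpha> x y * w y) xs) =
      (\<Sum>ys\<in>tuples B q. c xs * prod_list (map2 \<alpha> xs ys) * prod_list (map w ys))"
      unfolding prod_list_sum_expand len sum_distrib_left
      by (rule sum.cong) (simp_all add: len prod_split tuples_def mult.assoc)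
  qed simp
  also have "\<dots> = form B q (\<lambda>ys. \<Sum>xs\<in>tuples A q. c xs * prod_list (map2 \<alpha> xs ys)) w"
    by (subst sum.swap) (simp add: form_def sum_distrib_right)
  finally show ?thesis .
qed

lemma form_mult:
  "form A p c w * form A p' c' w = form A (p + p') (\<lambda>zs. c (take p zs) * c' (drop p zs)) w"
proof -
  have "form A p c w * form A p' c' w = (\<Sum>xs\<in>tuples A p. \<Sum>ys\<in>tuples A p'.
      c xs * prod_list (map w xs) * (c' ys * prod_list (map w ys)))"
    by (simp only: form_def sum_product)
  also have "\<dots> = form A (p + p') (\<lambda>zs. c (take p zs) * c' (drop p zs)) w"
    unfolding form_def sum_tuples_append by (intro sum.cong refl) (simp add: tuples_def)
  finally show ?thesis .
qed

lemma form_sum_coeffs: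
  "form A q (\<lambda>zs. \<Sum>x\<in>B. t x * e x zs) w = (\<Sum>x\<in>B. t x * form A q (e x) w)"
  unfolding form_def sum_distrib_left sum_distrib_right by (subst sum.swap) (simp only: mult.assoc)

definition symmetric_on :: "'a list set \<Rightarrow> ('a list \<Rightarrow> complex) \<Rightarrow> bool" where
  "symmetric_on T c \<longleftrightarrow> (\<forall>xs\<in>T. \<forall>ys. mset ys = mset xs \<longrightarrow> c ys = c xs)"

lemma symmetric_onD: "symmetric_on T c \<Longrightarrow> xs \<in> T \<Longrightarrow> mset ys = mset xs \<Longrightarrow> c ys = c xs"
  unfolding symmetric_on_def by blast

lemma mset_eq_tuples: "mset xs = mset ys \<Longrightarrow> xs \<in> tuples A q \<longleftrightarrow> ys \<in> tuples A q"
  unfolding tuples_def using mset_eq_length[of xs ys] mset_eq_setD[of xs ys] by simp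

lemma symmetric_on_Cons:
  "symmetric_on (tuples A (Suc q)) c \<Longrightarrow> x \<in> A \<Longrightarrow> symmetric_on (tuples A q) (\<lambda>xs. c (x # xs))"
  unfolding symmetric_on_def by (metis Cons_in_tuples_iff mset.simps(2))

text \<open>
  The average runs over the distinct rearrangements of \<open>xs\<close>, which all occur with the same
  frequency among the permutations of its positions; so it is the usual symmetrization.
\<close>

definition symmetrize :: "('a list \<Rightarrow> complex) \<Rightarrow> 'a list \<Rightarrow> complex" where
  "symmetrize c xs = (\<Sum>ys\<in>permutations_of_multiset (mset xs). c ys) /
     of_nat (card (permutations_of_multiset (mset xs)))"

lemma symmetric_on_symmetrize: "symmetric_on T (symmetrize c)"
  by (simp add: symmetric_on_def symmetrize_def)

lemma prod_list_map_mset_cong: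
  fixes w :: "'a \<Rightarrow> 'b :: comm_monoid_mult"
  assumes "mset xs = mset ys" shows "prod_list (map w xs) = prod_list (map w ys)"
  using assms by (metis mset_map prod_mset_prod_list)

lemma card_permutations_of_mset_pos: "card (permutations_of_multiset (mset xs)) > 0"
  by (simp add: card_gt_0_iff)

text \<open>
  The monomial attached to a list depends on the list only as a multiset, so moving coefficients
  around inside a class of rearrangements does not change the polynomial.
\<close>

lemma form_symmetrize:
  assumes "finite A" shows "form A q (symmetrize c) w = form A q c w"
proof -
  define N where "N xs = (of_nat (card (permutations_of_multiset (mset xs))) :: complex)" for xs :: "'a list"
  have N0: "N xs \<noteq> 0" for xs
    using card_permutations_of_mset_pos[of xs] by (simp add: N_def)
  have perm: "permutations_of_multiset (mset xs) = {ys\<in>tuples A q. mset xs = mset ys}"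
    if xs: "xs \<in> tuples A q" for xs
  proof (rule set_eqI)
    fix ys
    show "ys \<in> permutations_of_multiset (mset xs) \<longleftrightarrow> ys \<in> {ys\<in>tuples A q. mset xs = mset ys}"
      using mset_eq_tuples[of xs ys A q] xs by (simp add: permutations_of_multiset_def) metis
  qed
  have "form A q (symmetrize c) w =
    (\<Sum>xs\<in>tuples A q. \<Sum>ys | ys \<in> tuples A q \<and> mset xs = mset ys. c ys * prod_list (map w ys) / N ys)"
    unfolding form_def
  proof (rule sum.cong)
    fix xs assume "xs \<in> tuples A q"
    then have "symmetrize c xs * prod_list (map w xs) =
      (\<Sum>ys | ys \<in> tuples A q \<and> mset xs = mset ys. c ys * prod_list (map w xs) / N xs)"
      by (simp add: symmetrize_def perm N_def sum_distrib_right sum_divide_distrib)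
    also have "\<dots> = (\<Sum>ys | ys \<in> tuples A q \<and> mset xs = mset ys. c ys * prod_list (map w ys) / N ys)"
    proof (rule sum.cong)
      fix ys assume "ys \<in> {ys \<in> tuples A q. mset xs = mset ys}"
      then have "mset xs = mset ys" by simp
      then show "c ys * prod_list (map w xs) / N xs = c ys * prod_list (map w ys) / N ys"
        using prod_list_map_mset_cong[of xs ys w] by (simp add: N_def)
    qed simp
    finally show "symmetrize c xs * prod_list (map w xs) =
      (\<Sum>ys | ys \<in> tuples A q \<and> mset xs = mset ys. c ys * prod_list (map w ys) / N ys)" .
  qed simp
  also have "\<dots> = (\<Sum>ys\<in>tuples A q. \<Sum>xs | xs \<in> tuples A q \<and> mset xs = mset ys. c ys * prod_list (map w ys) / N ys)"
    using assms by (intro sum.swap_restrict) auto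
  also have "\<dots> = (\<Sum>ys\<in>tuples A q. c ys * prod_list (map w ys))"
  proof (rule sum.cong)
    fix ys assume ys: "ys \<in> tuples A q"
    have "of_nat (card {xs \<in> tuples A q. mset xs = mset ys}) = N ys"
      unfolding N_def perm[OF ys] by (rule arg_cong[where f = "\<lambda>S. of_nat (card S)"], rule Collect_cong) metis
    then show "(\<Sum>xs | xs \<in> tuples A q \<and> mset xs = mset ys. c ys * prod_list (map w ys) / N ys) =
        c ys * prod_list (map w ys)"
      using N0[of ys] by simp
  qed simp
  finally show ?thesis by (simp add: form_def)
qed

text \<open>
  An average obeys every bound that its terms obey. Since the weights in the norms are invariant
  under permutations, this makes it enough to estimate a non-symmetric coefficient family.
\<close>

lemma norm_symmetrize_le:
  assumes "\<And>ys. mset ys = mset xs \<Longrightarrow> cmod (c ys) \<le> B"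
  shows "cmod (symmetrize c xs) \<le> B"
proof -
  let ?S = "permutations_of_multiset (mset xs)"
  have "cmod (\<Sum>ys\<in>?S. c ys) \<le> of_nat (card ?S) * B"
    by (rule sum_norm_bound) (use assms in \<open>auto simp: permutations_of_multiset_def\<close>)
  then show ?thesis
    using card_permutations_of_mset_pos[of xs]
    by (simp add: symmetrize_def norm_divide field_simps)
qed

text \<open>
  The part of the product of all \<open>a x + b x\<close> that is linear in \<open>b\<close>: the Leibniz rule.
\<close>

primrec product_variation :: "('a \<Rightarrow> complex) \<Rightarrow> ('a \<Rightarrow> complex) \<Rightarrow> 'a list \<Rightarrow> complex" where
  "product_variation a b [] = 0"
| "product_variation a b (x # xs) = b x * prod_list (map a xs) + a x * product_variation a b xs"

text \<open>
  The linear bound on the variation is not wanted for itself; the induction on the list needs it,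
  because the quadratic remainder of a longer product contains \<open>b x\<close> times the
  variation of the shorter one.
\<close>

lemma product_first_order:
  "\<exists>C\<ge>0. \<forall>b n. 0 \<le> n \<longrightarrow> n \<le> 1 \<longrightarrow> (\<forall>x\<in>set xs. cmod (b x) \<le> n) \<longrightarrow>
     cmod (product_variation a b xs) \<le> C * n \<and>
     cmod (prod_list (map (\<lambda>x. a x + b x) xs) - prod_list (map a xs) - product_variation a b xs) \<le> C * n\<^sup>2"
proof (induction xs)
  case Nil
  show ?case by (rule exI[of _ 0]) auto
next
  case (Cons x xs)
  then obtain C where C: "C \<ge> 0"
    "\<And>b n. 0 \<le> n \<Longrightarrow> n \<le> 1 \<Longrightarrow> \<forall>x\<in>set xs. cmod (b x) \<le> n \<Longrightarrow>
     cmod (product_variation a b xs) \<le> C * n"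
    "\<And>b n. 0 \<le> n \<Longrightarrow> n \<le> 1 \<Longrightarrow> \<forall>x\<in>set xs. cmod (b x) \<le> n \<Longrightarrow>
     cmod (prod_list (map (\<lambda>x. a x + b x) xs) - prod_list (map a xs) - product_variation a b xs) \<le> C * n\<^sup>2"
    by auto
  let ?D = "cmod (prod_list (map a xs)) + 2 * C + cmod (a x) * C"
  have "cmod (product_variation a b (x # xs)) \<le> ?D * n \<and>
     cmod (prod_list (map (\<lambda>x. a x + b x) (x # xs)) - prod_list (map a (x # xs)) - product_variation a b (x # xs)) \<le> ?D * n\<^sup>2"
    if n: "0 \<le> n" "n \<le> 1" and b: "\<forall>x\<in>set (x # xs). cmod (b x) \<le> n" for b n
  proof -
    define p where "p = prod_list (map a xs)"
    define v where "v = product_variation a b xs"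
    define \<rho> where "\<rho> = prod_list (map (\<lambda>x. a x + b x) xs) - p - v"
    have b': "cmod (b x) \<le> n" "\<forall>x\<in>set xs. cmod (b x) \<le> n" using b by auto
    have v: "cmod v \<le> C * n" and \<rho>: "cmod \<rho> \<le> C * n\<^sup>2"
      using C(2,3)[OF n b'(2)] by (simp_all add: v_def \<rho>_def p_def)
    have 1: "cmod (b x * p + a x * v) \<le> n * cmod p + cmod (a x) * (C * n)"
      by (rule order_trans[OF norm_triangle_ineq])
         (use n in \<open>auto simp: norm_mult intro!: add_mono mult_mono b' v\<close>)
    have "C * n\<^sup>2 \<le> C * n"
      using n C(1) by (simp add: mult_left_mono power2_eq_square mult_left_le)
    with \<rho> have \<rho>': "cmod \<rho> \<le> C * n" by linarith
    have "cmod (b x * (v + \<rho>) + a x * \<rho>) \<le> n * (C * n + C * n) + cmod (a x) * (C * n\<^sup>2)"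
      by (rule order_trans[OF norm_triangle_ineq], unfold norm_mult)
         (intro add_mono mult_mono b' order_trans[OF norm_triangle_ineq] v \<rho> \<rho>', use n C(1) in auto)
    moreover have "b x * (v + \<rho>) + a x * \<rho> =
       prod_list (map (\<lambda>x. a x + b x) (x # xs)) - prod_list (map a (x # xs)) - product_variation a b (x # xs)"
      by (simp add: \<rho>_def v_def p_def algebra_simps)
    moreover have "n * (C * n + C * n) + cmod (a x) * (C * n\<^sup>2) \<le> ?D * n\<^sup>2"
      using n by (simp add: algebra_simps power2_eq_square)
    moreover have "n * cmod p + cmod (a x) * (C * n) \<le> ?D * n"
      using n C(1) by (simp add: algebra_simps p_def)
    ultimately show ?thesis
      using 1 by (auto simp: p_def v_def)
  qed
  moreover have "?D \<ge> 0" using C(1) by auto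
  ultimately show ?case by (intro exI[of _ ?D]) simp
qed

text \<open>
  In the Leibniz rule each of the \<open>q\<close> positions is varied once; for symmetric coefficients
  the varied position can be moved to the front, and all positions contribute equally.
\<close>

lemma sum_product_variation:
  assumes "symmetric_on (tuples A q) c"
  shows "(\<Sum>xs\<in>tuples A q. c xs * product_variation a b xs) =
    of_nat q * (\<Sum>x\<in>A. b x * form A (q - 1) (\<lambda>xs. c (x # xs)) a)"
  using assms
proof (induction q arbitrary: c)
  case 0
  then show ?case by simp
next
  case (Suc q)
  have "(\<Sum>xs\<in>tuples A (Suc q). c xs * product_variation a b xs) =
     (\<Sum>x\<in>A. b x * form A q (\<lambda>xs. c (x # xs)) a) +
     (\<Sum>x\<in>A. a x * (\<Sum>xs\<in>tuples A q. c (x # xs) * product_variation a b xs))"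
    by (simp add: sum_tuples_Suc form_def algebra_simps sum.distrib sum_distrib_left)
  also have "(\<Sum>x\<in>A. a x * (\<Sum>xs\<in>tuples A q. c (x # xs) * product_variation a b xs)) =
     (\<Sum>x\<in>A. a x * (of_nat q * (\<Sum>y\<in>A. b y * form A (q - 1) (\<lambda>xs. c (x # y # xs)) a)))"
    by (intro sum.cong refl arg_cong2[where f = "(*)"] Suc.IH symmetric_on_Cons[OF Suc.prems])
  also have "\<dots> = of_nat q * (\<Sum>y\<in>A. b y * form A q (\<lambda>xs. c (y # xs)) a)"
  proof (cases q)
    case 0
    then show ?thesis by simp
  next
    case (Suc p)
    have "(\<Sum>x\<in>A. a x * (of_nat q * (\<Sum>y\<in>A. b y * form A (q - 1) (\<lambda>xs. c (x # y # xs)) a))) =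
      of_nat q * (\<Sum>x\<in>A. \<Sum>y\<in>A. a x * b y * form A p (\<lambda>xs. c (x # y # xs)) a)"
      by (simp add: Suc sum_distrib_left algebra_simps)
    also have "\<dots> = of_nat q * (\<Sum>y\<in>A. \<Sum>x\<in>A. a x * b y * form A p (\<lambda>xs. c (y # x # xs)) a)"
    proof -
      have "form A p (\<lambda>xs. c (x # y # xs)) a = form A p (\<lambda>xs. c (y # x # xs)) a"
        if "x \<in> A" "y \<in> A" for x y
        by (rule form_cong) (use that Suc Suc.prems in \<open>auto intro!: symmetric_onD[of "tuples A (Suc q)" c]\<close>)
      then show ?thesis by (subst sum.swap) simp
    qed
    also have "\<dots> = of_nat q * (\<Sum>y\<in>A. b y * form A q (\<lambda>xs. c (y # xs)) a)"
      by (simp add: Suc form_Suc sum_distrib_left algebra_simps)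
    finally show ?thesis .
  qed
  finally show ?case by (simp add: algebra_simps)
qed

text \<open>
  First-order Taylor expansion of a symmetric form with a quadratic remainder. It gives the
  gradients below and also drives the induction that identifies coefficients.
\<close>

lemma form_first_order:
  assumes "finite A" "symmetric_on (tuples A q) c"
  obtains C where "\<And>b n. 0 \<le> n \<Longrightarrow> n \<le> 1 \<Longrightarrow> (\<And>x. x \<in> A \<Longrightarrow> cmod (b x) \<le> n) \<Longrightarrow>
     cmod (form A q c (\<lambda>x. a x + b x) - form A q c a -
       of_nat q * (\<Sum>x\<in>A. b x * form A (q - 1) (\<lambda>xs. c (x # xs)) a)) \<le> C * n\<^sup>2"
proof -
  obtain K where K: "\<And>xs b n. 0 \<le> n \<Longrightarrow> n \<le> 1 \<Longrightarrow> \<forall>x\<in>set xs. cmod (b x) \<le> n \<Longrightarrow>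
     cmod (prod_list (map (\<lambda>x. a x + b x) xs) - prod_list (map a xs) - product_variation a b xs) \<le> K xs * n\<^sup>2"
    using product_first_order[where a = a] by metis
  show ?thesis
  proof (rule that[of "\<Sum>xs\<in>tuples A q. cmod (c xs) * K xs"])
    fix b and n :: real
    assume n: "0 \<le> n" "n \<le> 1" and b: "\<And>x. x \<in> A \<Longrightarrow> cmod (b x) \<le> n"
    have "form A q c (\<lambda>x. a x + b x) - form A q c a -
       of_nat q * (\<Sum>x\<in>A. b x * form A (q - 1) (\<lambda>xs. c (x # xs)) a) =
       (\<Sum>xs\<in>tuples A q. c xs * (prod_list (map (\<lambda>x. a x + b x) xs) - prod_list (map a xs) - product_variation a b xs))"
      unfolding sum_product_variation[OF assms(2), symmetric]
      by (simp only: form_def right_diff_distrib sum_subtractf)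
    also have "cmod \<dots> \<le> (\<Sum>xs\<in>tuples A q. cmod (c xs) * (K xs * n\<^sup>2))"
    proof (rule sum_norm_le, unfold norm_mult, intro mult_left_mono K n)
      fix xs assume "xs \<in> tuples A q"
      then show "\<forall>x\<in>set xs. cmod (b x) \<le> n" using b by (auto simp: tuples_def)
    qed auto
    finally show "cmod (form A q c (\<lambda>x. a x + b x) - form A q c a -
       of_nat q * (\<Sum>x\<in>A. b x * form A (q - 1) (\<lambda>xs. c (x # xs)) a)) \<le> (\<Sum>xs\<in>tuples A q. cmod (c xs) * K xs) * n\<^sup>2"
      by (simp add: sum_distrib_right mult.assoc)
  qed
qed

section \<open>Gradients of real polynomials\<close>

text \<open>
  A coordinate \<open>(k, s)\<close> stands for \<open>u k\<close> when \<open>s = 1\<close> and for its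
  conjugate when \<open>s = -1\<close>, so that a pair of a sign tuple and a mode tuple becomes one list and
  polynomials in \<open>u\<close> and its conjugate become forms over these coordinates.
\<close>

definition signed_modes :: "real \<Rightarrow> (idx \<times> int) set" where
  "signed_modes M = modes M \<times> {-1, 1}"

definition signed_coord :: "(idx \<Rightarrow> complex) \<Rightarrow> idx \<times> int \<Rightarrow> complex" where
  "signed_coord u x = sign_conj (snd x) (u (fst x))"

lemma modes_eq: "0 \<le> M \<Longrightarrow> modes M = (SIGMA l:{..nat \<lfloor>M\<rfloor>}. {- int l..int l})"
  by (auto simp: modes_def le_nat_iff le_floor_iff)

lemma finite_modes [simp]: "finite (modes M)"
proof (cases "0 \<le> M")
  case False
  then have "modes M = {}" by (auto simp: modes_def)
  then show ?thesis by simp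
qed (simp add: modes_eq)

lemma finite_signed_modes [simp]: "finite (signed_modes M)"
  by (simp add: signed_modes_def)

lemma sum_signed_modes:
  "(\<Sum>x\<in>signed_modes M. f x) = (\<Sum>k\<in>modes M. f (k, 1) + f (k, -1))"
proof -
  have "(\<Sum>x\<in>signed_modes M. f x) = (\<Sum>k\<in>modes M. \<Sum>s\<in>{-1, 1}. f (k, s))"
    unfolding signed_modes_def by (simp only: sum.cartesian_product case_prod_unfold prod.collapse)
  then show ?thesis by (simp add: add.commute)
qed

lemma signed_coord_1 [simp]: "signed_coord u (k, 1) = u k"
  and signed_coord_minus_1 [simp]: "signed_coord u (k, -1) = cnj (u k)"
  by (simp_all add: signed_coord_def sign_conj_def)

lemma norm_signed_coord: "cmod (signed_coord u x) = cmod (u (fst x))"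
  by (simp add: signed_coord_def sign_conj_def)

lemma signed_coord_add: "signed_coord (\<lambda>k. u k + h k) x = signed_coord u x + signed_coord h x"
  by (simp add: signed_coord_def sign_conj_def)

lemma signed_coord_scale: "signed_coord (\<lambda>k. of_real t * h k) x = of_real t * signed_coord h x"
  by (simp add: signed_coord_def sign_conj_def)

definition flip :: "idx \<times> int \<Rightarrow> idx \<times> int" where
  "flip x = (fst x, - snd x)"

lemma flip_flip [simp]: "flip (flip x) = x"
  by (simp add: flip_def)

lemma flip_comp_flip [simp]: "flip \<circ> flip = id"
  by (simp add: fun_eq_iff)

lemma flip_in_signed_modes: "x \<in> signed_modes M \<Longrightarrow> flip x \<in> signed_modes M"
  by (auto simp: signed_modes_def flip_def)

lemma map_flip_in_tuples: "xs \<in> tuples (signed_modes M) q \<Longrightarrow> map flip xs \<in> tuples (signed_modes M) q"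
  using flip_in_signed_modes by (auto simp: tuples_def)

lemma signed_coord_flip: "x \<in> signed_modes M \<Longrightarrow> signed_coord u (flip x) = cnj (signed_coord u x)"
  by (auto simp: signed_modes_def signed_coord_def sign_conj_def flip_def)

lemma cnj_form_signed_coord:
  "cnj (form (signed_modes M) q c (signed_coord u)) =
    form (signed_modes M) q (\<lambda>xs. cnj (c (map flip xs))) (signed_coord u)"
proof -
  have "cnj (form (signed_modes M) q c (signed_coord u)) =
    form (signed_modes M) q (\<lambda>xs. cnj (c xs)) (\<lambda>x. signed_coord u (flip x))"
    unfolding cnj_form by (rule form_cong) (simp_all add: signed_coord_flip)
  also have "\<dots> = form (signed_modes M) q (\<lambda>xs. cnj (c (map flip xs))) (signed_coord u)"
    unfolding form_def
    by (rule sum.reindex_bij_witness[where i = "map flip" and j = "map flip"])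
       (auto simp: map_flip_in_tuples comp_def)
  finally show ?thesis .
qed

lemma eq_0_if_le_linear:
  fixes x C :: real
  assumes "0 \<le> x" "\<And>t. 0 < t \<Longrightarrow> t \<le> 1 \<Longrightarrow> x \<le> C * t"
  shows "x = 0"
proof (rule ccontr)
  assume "x \<noteq> 0"
  with assms(1) have x: "x > 0" by simp
  define t where "t = min 1 (x / (2 * (\<bar>C\<bar> + 1)))"
  have "0 < t" "t \<le> 1" using x by (auto simp: t_def)
  then have "x \<le> C * t" by (rule assms(2))
  also have "\<dots> \<le> (\<bar>C\<bar> + 1) * t" using \<open>0 < t\<close> by (intro mult_right_mono) auto
  also have "\<dots> \<le> (\<bar>C\<bar> + 1) * (x / (2 * (\<bar>C\<bar> + 1)))" by (intro mult_left_mono) (auto simp: t_def)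
  also have "\<dots> = x / 2" by (simp add: field_simps add_eq_0_iff)
  finally show False using x by simp
qed

text \<open>
  A polynomial in \<open>u\<close> and its conjugate that vanishes identically has zero symmetric
  coefficients, although the two sets of coordinates are not independent over the reals. If the form
  vanishes, so does its derivative in every direction. The directions \<open>e\<^sub>k\<close> and
  \<open>\<i> e\<^sub>k\<close> separate the derivative with respect to \<open>u k\<close> from the one with
  respect to its conjugate, and both are forms of one degree less.
\<close>

lemma symmetric_coeffs_vanish:
  assumes "symmetric_on (tuples (signed_modes M) q) c"
    and "\<And>u. u \<in> states M \<Longrightarrow> form (signed_modes M) q c (signed_coord u) = 0"
    and "xs \<in> tuples (signed_modes M) q"
  shows "c xs = 0"
  using assms
proof (induction q arbitrary: c xs)
  case 0
  have "(\<lambda>_. 0) \<in> states M" by (simp add: states_def)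
  from 0(2)[OF this] 0(3) show ?case by (simp add: form_def)
next
  case (Suc q)
  let ?A = "signed_modes M"
  let ?G = "\<lambda>u x. form ?A q (\<lambda>xs. c (x # xs)) (signed_coord u)"
  have deriv0: "(\<Sum>x\<in>?A. signed_coord h x * ?G u x) = 0"
    if u: "u \<in> states M" and h: "h \<in> states M" "\<And>k. cmod (h k) \<le> 1" for u h
  proof -
    define D where "D = (\<Sum>x\<in>?A. signed_coord h x * ?G u x)"
    obtain C where C: "\<And>b n. 0 \<le> n \<Longrightarrow> n \<le> 1 \<Longrightarrow> (\<And>x. x \<in> ?A \<Longrightarrow> cmod (b x) \<le> n) \<Longrightarrow>
       cmod (form ?A (Suc q) c (\<lambda>x. signed_coord u x + b x) - form ?A (Suc q) c (signed_coord u) -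
         of_nat (Suc q) * (\<Sum>x\<in>?A. b x * form ?A (Suc q - 1) (\<lambda>xs. c (x # xs)) (signed_coord u))) \<le> C * n\<^sup>2"
      using form_first_order[OF finite_signed_modes Suc.prems(1)] by blast
    have "cmod (of_nat (Suc q) * D) \<le> C * t" if t: "0 < t" "t \<le> 1" for t
    proof -
      let ?b = "\<lambda>x. of_real t * signed_coord h x"
      have "cmod (?b x) \<le> t" for x
        using t h(2) by (simp add: norm_mult norm_signed_coord mult_left_le)
      with C[of t ?b] t have "cmod (form ?A (Suc q) c (\<lambda>x. signed_coord u x + ?b x) - form ?A (Suc q) c (signed_coord u) -
         of_nat (Suc q) * (\<Sum>x\<in>?A. ?b x * ?G u x)) \<le> C * t\<^sup>2"
        by simp
      moreover have "form ?A (Suc q) c (\<lambda>x. signed_coord u x + ?b x) = 0"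
      proof -
        have "(\<lambda>k. u k + of_real t * h k) \<in> states M" using u h by (simp add: states_def)
        from Suc.prems(2)[OF this] show ?thesis
          by (simp only: signed_coord_add signed_coord_scale)
      qed
      moreover have "form ?A (Suc q) c (signed_coord u) = 0"
        using Suc.prems(2)[OF u] .
      moreover have "(\<Sum>x\<in>?A. ?b x * ?G u x) = of_real t * D"
        by (simp add: D_def sum_distrib_left mult.assoc)
      ultimately have "cmod (0 - 0 - of_nat (Suc q) * (of_real t * D)) \<le> C * t\<^sup>2"
        by (simp only:)
      moreover have "cmod (0 - 0 - of_nat (Suc q) * (of_real t * D)) = t * cmod (of_nat (Suc q) * D)"
        using t by (simp add: norm_mult del: of_nat_Suc)
      ultimately have "t * cmod (of_nat (Suc q) * D) \<le> t * (C * t)"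
        by (simp only: power2_eq_square mult.left_commute)
      then show ?thesis using t by (simp only: mult_le_cancel_left_pos)
    qed
    then have "cmod (of_nat (Suc q) * D) = 0"
      by (rule eq_0_if_le_linear[rotated]) auto
    then show ?thesis by (simp add: D_def del: of_nat_Suc)
  qed
  obtain k s ys where xs: "xs = (k, s) # ys" and k: "k \<in> modes M" and s: "s \<in> {-1, 1}"
    and ys: "ys \<in> tuples ?A q"
    using Suc.prems(3) by (cases xs) (auto simp: tuples_def signed_modes_def)
  have partial0: "?G u (k, s) = 0" if u: "u \<in> states M" for u
  proof -
    let ?e = "\<lambda>z j. if j = k then z else (0::complex)"
    have eval: "z * ?G u (k, 1) + cnj z * ?G u (k, -1) = 0" if z: "cmod z \<le> 1" for z
    proof -
      have "(\<Sum>x\<in>?A. signed_coord (?e z) x * ?G u x) = 0"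
        by (rule deriv0[OF u]) (use k z in \<open>auto simp: states_def\<close>)
      also have "(\<Sum>x\<in>?A. signed_coord (?e z) x * ?G u x) =
          (\<Sum>j\<in>modes M. if j = k then z * ?G u (k, 1) + cnj z * ?G u (k, -1) else 0)"
        unfolding sum_signed_modes by (rule sum.cong) auto
      finally show ?thesis using k by simp
    qed
    have e1: "?G u (k, 1) + ?G u (k, -1) = 0" using eval[of 1] by simp
    have "\<i> * (?G u (k, 1) - ?G u (k, -1)) = 0" using eval[of \<i>] by (simp add: algebra_simps)
    then have "?G u (k, 1) = ?G u (k, -1)" by simp
    with e1 s show ?thesis by auto
  qed
  have sym: "symmetric_on (tuples ?A q) (\<lambda>ys. c ((k, s) # ys))"
    by (rule symmetric_on_Cons[OF Suc.prems(1)]) (use k s in \<open>auto simp: signed_modes_def\<close>)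
  show ?case
    using Suc.IH[OF sym partial0 ys] by (simp only: xs)
qed

lemma symmetric_coeffs_unique:
  assumes "symmetric_on (tuples (signed_modes M) q) c" "symmetric_on (tuples (signed_modes M) q) c'"
    and "\<And>u. u \<in> states M \<Longrightarrow>
      form (signed_modes M) q c (signed_coord u) = form (signed_modes M) q c' (signed_coord u)"
    and "xs \<in> tuples (signed_modes M) q"
  shows "c xs = c' xs"
proof -
  have "symmetric_on (tuples (signed_modes M) q) (\<lambda>xs. c xs - c' xs)"
    using assms(1,2) unfolding symmetric_on_def by metis
  from symmetric_coeffs_vanish[OF this _ assms(4)] assms(3) show ?thesis
    by (simp add: form_def algebra_simps sum_subtractf)
qed

lemma l2_inner_self: "l2_inner M u u = (\<Sum>k\<in>modes M. (cmod (u k))\<^sup>2)"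
  unfolding cmod_power2 by (simp add: l2_inner_def power2_eq_square)

lemma l2_norm_nonneg: "0 \<le> l2_norm M u"
  by (simp add: l2_norm_def l2_inner_self sum_nonneg)

lemma l2_norm_power2: "(l2_norm M u)\<^sup>2 = l2_inner M u u"
  by (simp add: l2_norm_def l2_inner_self sum_nonneg)

lemma cmod_le_l2_norm:
  assumes "k \<in> modes M" shows "cmod (u k) \<le> l2_norm M u"
proof -
  have "(cmod (u k))\<^sup>2 \<le> (\<Sum>k\<in>modes M. (cmod (u k))\<^sup>2)"
    using assms by (intro member_le_sum) auto
  then show ?thesis
    unfolding l2_norm_def l2_inner_self by (rule real_le_rsqrt)
qed

lemma has_gradient_unique:
  assumes "has_gradient M P u v" "has_gradient M P u v'"
  shows "v = v'"
proof (rule ccontr)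
  assume "v \<noteq> v'"
  define w where "w = (\<lambda>k. v k - v' k)"
  have w: "w \<in> states M" using assms by (simp add: has_gradient_def states_def w_def)
  define N where "N = l2_norm M w"
  have "N > 0"
  proof -
    obtain k where k: "w k \<noteq> 0" using \<open>v \<noteq> v'\<close> by (auto simp: w_def fun_eq_iff)
    then have "k \<in> modes M" using w unfolding states_def by blast
    from cmod_le_l2_norm[OF this, of w] k show ?thesis
      unfolding N_def by (meson less_le_trans zero_less_norm_iff)
  qed
  then have e: "N / 4 > 0" by simp
  obtain d1 where d1: "d1 > 0" "\<And>h. h \<in> states M \<Longrightarrow> l2_norm M h < d1 \<Longrightarrow>
      \<bar>P (\<lambda>k. u k + h k) - P u - l2_inner M v h\<bar> \<le> N / 4 * l2_norm M h"
    using assms(1) e unfolding has_gradient_def by blast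
  obtain d2 where d2: "d2 > 0" "\<And>h. h \<in> states M \<Longrightarrow> l2_norm M h < d2 \<Longrightarrow>
      \<bar>P (\<lambda>k. u k + h k) - P u - l2_inner M v' h\<bar> \<le> N / 4 * l2_norm M h"
    using assms(2) e unfolding has_gradient_def by blast
  \<comment> \<open>Test along \<open>w\<close> itself, scaled so that \<open>h = t w\<close> has norm \<open>min d1 d2 / 2\<close>.\<close>
  define t where "t = min d1 d2 / (2 * N)"
  have t: "t > 0" using d1 d2 \<open>N > 0\<close> by (simp add: t_def)
  define h where "h = (\<lambda>k. of_real t * w k)"
  have h: "h \<in> states M" using w by (simp add: states_def h_def)
  have inner: "l2_inner M w h = t * N\<^sup>2"
    by (simp add: l2_norm_power2 N_def h_def l2_inner_def sum_distrib_left algebra_simps)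
  have normh: "l2_norm M h = t * N"
  proof -
    have "l2_inner M h h = t\<^sup>2 * l2_inner M w w"
      by (simp add: l2_inner_self h_def norm_mult power_mult_distrib sum_distrib_left)
    then show ?thesis using t by (simp add: l2_norm_def N_def real_sqrt_mult)
  qed
  then have "l2_norm M h = min d1 d2 / 2" using \<open>N > 0\<close> by (simp add: t_def)
  then have "l2_norm M h < d1" "l2_norm M h < d2" using d1 d2 by auto
  with d1(2)[OF h] d2(2)[OF h]
  have "\<bar>P (\<lambda>k. u k + h k) - P u - l2_inner M v h\<bar> \<le> N / 4 * l2_norm M h"
    and "\<bar>P (\<lambda>k. u k + h k) - P u - l2_inner M v' h\<bar> \<le> N / 4 * l2_norm M h"
    by blast+
  then have "\<bar>l2_inner M v h - l2_inner M v' h\<bar> \<le> N / 2 * l2_norm M h"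
    by linarith
  moreover have "l2_inner M v h - l2_inner M v' h = l2_inner M w h"
    by (simp add: l2_inner_def w_def sum_subtractf algebra_simps)
  ultimately have "t * N\<^sup>2 \<le> N / 2 * (t * N)" by (simp add: inner normh)
  moreover have "t * N\<^sup>2 > 0" using t \<open>N > 0\<close> by simp
  moreover have "N / 2 * (t * N) = t * N\<^sup>2 / 2" by (simp add: power2_eq_square)
  ultimately show False by linarith
qed

text \<open>
  For the real scalar product the gradient is twice the derivative with respect to the conjugate
  coordinate; symmetry of the coefficients turns that derivative into \<open>q\<close> times the
  form with its first entry fixed.
\<close>

definition polynomial_gradient ::
  "real \<Rightarrow> nat \<Rightarrow> ((idx \<times> int) list \<Rightarrow> complex) \<Rightarrow> (idx \<Rightarrow> complex) \<Rightarrow> idx \<Rightarrow> complex" where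
  "polynomial_gradient M q c u k = (if k \<in> modes M then
     2 * of_nat q * form (signed_modes M) (q - 1) (\<lambda>xs. c ((k, -1) # xs)) (signed_coord u) else 0)"

text \<open>
  For a real polynomial the derivatives with respect to \<open>u k\<close> and to its conjugate are
  conjugate to each other.
\<close>

lemma cnj_form_partial:
  assumes "\<And>xs. xs \<in> tuples (signed_modes M) q \<Longrightarrow> c (map flip xs) = cnj (c xs)"
    and "q \<ge> 1" "k \<in> modes M"
  shows "cnj (form (signed_modes M) (q - 1) (\<lambda>xs. c ((k, -1) # xs)) (signed_coord u)) =
    form (signed_modes M) (q - 1) (\<lambda>xs. c ((k, 1) # xs)) (signed_coord u)"
  unfolding cnj_form_signed_coord
proof (rule form_cong)
  fix xs assume "xs \<in> tuples (signed_modes M) (q - 1)"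
  then have "(k, -1) # map flip xs \<in> tuples (signed_modes M) (Suc (q - 1))"
    using assms(3) map_flip_in_tuples by (auto simp: signed_modes_def)
  with assms(1)[of "(k, -1) # map flip xs"] assms(2)
  show "cnj (c ((k, - 1) # map flip xs)) = c ((k, 1) # xs)"
    by (simp add: flip_def[of "(k, -1)"])
qed simp

text \<open>
  The linear term of the first-order expansion pairs each derivative with its conjugate, so it is
  twice a real part, which is the real scalar product with the gradient.
\<close>

lemma has_gradient_polynomial:
  assumes sym: "symmetric_on (tuples (signed_modes M) q) c"
    and real: "\<And>xs. xs \<in> tuples (signed_modes M) q \<Longrightarrow> c (map flip xs) = cnj (c xs)"
    and P: "\<And>u. u \<in> states M \<Longrightarrow> of_real (P u) = form (signed_modes M) q c (signed_coord u)"
    and u: "u \<in> states M" and q: "q \<ge> 1"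
  shows "has_gradient M P u (polynomial_gradient M q c u)"
  unfolding has_gradient_def
proof (intro conjI allI impI)
  let ?A = "signed_modes M" and ?v = "polynomial_gradient M q c u"
  let ?G = "\<lambda>x. form ?A (q - 1) (\<lambda>xs. c (x # xs)) (signed_coord u)"
  show "?v \<in> states M" by (simp add: states_def polynomial_gradient_def)
  have inner: "of_real (l2_inner M ?v h) = of_nat q * (\<Sum>x\<in>?A. signed_coord h x * ?G x)" for h
  proof -
    have "of_nat q * (\<Sum>x\<in>?A. signed_coord h x * ?G x) =
      (\<Sum>k\<in>modes M. of_nat q * (h k * ?G (k, 1) + cnj (h k) * ?G (k, -1)))"
      by (simp add: sum_signed_modes sum_distrib_left)
    also have "\<dots> = (\<Sum>k\<in>modes M. of_real (Re (?v k * cnj (h k))))"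
    proof (rule sum.cong)
      fix k assume k: "k \<in> modes M"
      have "h k * ?G (k, 1) = cnj (?G (k, -1) * cnj (h k))"
        by (simp only: complex_cnj_mult complex_cnj_cnj mult.commute
            cnj_form_partial[where c = c and q = q, OF real q k])
      then have "h k * ?G (k, 1) + cnj (h k) * ?G (k, -1) = of_real (2 * Re (?G (k, -1) * cnj (h k)))"
        by (simp add: complex_eq_iff)
      then have "of_nat q * (h k * ?G (k, 1) + cnj (h k) * ?G (k, -1)) =
          of_real (of_nat q * (2 * Re (?G (k, -1) * cnj (h k))))"
        by simp
      also have "of_nat q * (2 * Re (?G (k, -1) * cnj (h k))) = Re (?v k * cnj (h k))"
        using k by (simp add: polynomial_gradient_def algebra_simps)
      finally show "of_nat q * (h k * ?G (k, 1) + cnj (h k) * ?G (k, -1)) =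
        of_real (Re (?v k * cnj (h k)))" .
    qed simp
    finally show ?thesis by (simp add: l2_inner_def)
  qed
  fix e :: real assume e: "e > 0"
  obtain C where C: "\<And>b n. 0 \<le> n \<Longrightarrow> n \<le> 1 \<Longrightarrow> (\<And>x. x \<in> ?A \<Longrightarrow> cmod (b x) \<le> n) \<Longrightarrow>
     cmod (form ?A q c (\<lambda>x. signed_coord u x + b x) - form ?A q c (signed_coord u) -
       of_nat q * (\<Sum>x\<in>?A. b x * ?G x)) \<le> C * n\<^sup>2"
    using form_first_order[OF finite_signed_modes sym] by blast
  define d where "d = min 1 (e / (\<bar>C\<bar> + 1))"
  have d: "d > 0" "d \<le> 1" using e by (auto simp: d_def)
  show "\<exists>d>0. \<forall>h\<in>states M. l2_norm M h < d \<longrightarrow>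
        \<bar>P (\<lambda>k. u k + h k) - P u - l2_inner M ?v h\<bar> \<le> e * l2_norm M h"
  proof (intro exI[of _ d] conjI ballI impI d)
    fix h assume h: "h \<in> states M" and small: "l2_norm M h < d"
    define n where "n = l2_norm M h"
    have n: "0 \<le> n" "n \<le> 1" "n \<le> d" using small d by (auto simp: n_def l2_norm_nonneg)
    have b: "cmod (signed_coord h x) \<le> n" if "x \<in> ?A" for x
      using that by (auto simp: norm_signed_coord n_def signed_modes_def intro!: cmod_le_l2_norm)
    have uh: "(\<lambda>k. u k + h k) \<in> states M" using u h by (simp add: states_def)
    have coord_add: "signed_coord (\<lambda>k. u k + h k) = (\<lambda>x. signed_coord u x + signed_coord h x)"
      by (rule ext) (rule signed_coord_add)
    have "complex_of_real (P (\<lambda>k. u k + h k) - P u - l2_inner M ?v h) =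
      form ?A q c (\<lambda>x. signed_coord u x + signed_coord h x) - form ?A q c (signed_coord u) -
       of_nat q * (\<Sum>x\<in>?A. signed_coord h x * ?G x)"
      by (simp only: of_real_diff P[OF uh] P[OF u] inner coord_add)
    then have "cmod (complex_of_real (P (\<lambda>k. u k + h k) - P u - l2_inner M ?v h)) \<le> C * n\<^sup>2"
      using C[OF n(1,2) b] by (simp only:)
    then have "\<bar>P (\<lambda>k. u k + h k) - P u - l2_inner M ?v h\<bar> \<le> C * n\<^sup>2"
      by (simp only: norm_of_real)
    also have "\<dots> \<le> (\<bar>C\<bar> + 1) * (e / (\<bar>C\<bar> + 1)) * n"
    proof -
      have "C * n \<le> (\<bar>C\<bar> + 1) * d" using n by (intro mult_mono) auto
      also have "\<dots> \<le> (\<bar>C\<bar> + 1) * (e / (\<bar>C\<bar> + 1))" by (intro mult_left_mono) (auto simp: d_def)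
      finally show ?thesis using n mult_right_mono[of "C * n" _ n] by (simp add: power2_eq_square mult.assoc)
    qed
    also have "\<dots> = e * n" by (simp add: field_simps add_eq_0_iff)
    finally show "\<bar>P (\<lambda>k. u k + h k) - P u - l2_inner M ?v h\<bar> \<le> e * l2_norm M h"
      by (simp add: n_def)
  qed
qed

lemma gradient_polynomial:
  assumes "symmetric_on (tuples (signed_modes M) q) c"
    and "\<And>xs. xs \<in> tuples (signed_modes M) q \<Longrightarrow> c (map flip xs) = cnj (c xs)"
    and "\<And>u. u \<in> states M \<Longrightarrow> of_real (P u) = form (signed_modes M) q c (signed_coord u)"
    and "u \<in> states M" "q \<ge> 1"
  shows "gradient M P u = polynomial_gradient M q c u"
  unfolding gradient_def
  using has_gradient_polynomial[OF assms] has_gradient_unique by blast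

section \<open>Coefficient families\<close>

lemma map_fst_snd_in_tuples:
  assumes "xs \<in> tuples (signed_modes M) q"
  shows "map snd xs \<in> sign_tuples q" "map fst xs \<in> mode_tuples M q"
  using assms by (auto simp: tuples_def signed_modes_def sign_tuples_def mode_tuples_def)

lemma zip_in_tuples:
  assumes "\<sigma> \<in> sign_tuples q" "k \<in> mode_tuples M q"
  shows "zip k \<sigma> \<in> tuples (signed_modes M) q"
  using assms by (fastforce simp: tuples_def signed_modes_def sign_tuples_def mode_tuples_def
      dest: set_zip_leftD set_zip_rightD)

lemma map_flip_eq: "map snd (map flip xs) = map uminus (map snd xs)" "map fst (map flip xs) = map fst xs"
  by (simp_all add: flip_def)

lemma coefficient_sum_eq_form:
  "(\<Sum>\<sigma>\<in>sign_tuples q. \<Sum>k\<in>mode_tuples M q. C \<sigma> k * (\<Prod>j<q. sign_conj (\<sigma> ! j) (u (k ! j)))) =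
    form (signed_modes M) q (\<lambda>xs. C (map snd xs) (map fst xs)) (signed_coord u)"
proof -
  have "(\<Sum>\<sigma>\<in>sign_tuples q. \<Sum>k\<in>mode_tuples M q. C \<sigma> k * (\<Prod>j<q. sign_conj (\<sigma> ! j) (u (k ! j)))) =
    (\<Sum>(\<sigma>, k)\<in>sign_tuples q \<times> mode_tuples M q. C \<sigma> k * (\<Prod>j<q. sign_conj (\<sigma> ! j) (u (k ! j))))"
    by (simp add: sum.cartesian_product)
  also have "\<dots> = form (signed_modes M) q (\<lambda>xs. C (map snd xs) (map fst xs)) (signed_coord u)"
    unfolding form_def
  proof (rule sum.reindex_bij_witness[where i = "\<lambda>xs. (map snd xs, map fst xs)" and j = "\<lambda>(\<sigma>, k). zip k \<sigma>"])
    fix a assume a: "a \<in> sign_tuples q \<times> mode_tuples M q"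
    obtain \<sigma> k where [simp]: "a = (\<sigma>, k)" by force
    have len: "length \<sigma> = q" "length k = q" using a by (auto simp: sign_tuples_def mode_tuples_def)
    show "(map snd (case a of (\<sigma>, k) \<Rightarrow> zip k \<sigma>), map fst (case a of (\<sigma>, k) \<Rightarrow> zip k \<sigma>)) = a"
      using len by simp
    show "(case a of (\<sigma>, k) \<Rightarrow> zip k \<sigma>) \<in> tuples (signed_modes M) q"
      using a zip_in_tuples by auto
    have "prod_list (map (signed_coord u) (zip k \<sigma>)) = (\<Prod>j<q. sign_conj (\<sigma> ! j) (u (k ! j)))"
      using len by (simp add: prod.list_conv_set_nth signed_coord_def atLeast0LessThan)
    then show "C (map snd (case a of (\<sigma>, k) \<Rightarrow> zip k \<sigma>)) (map fst (case a of (\<sigma>, k) \<Rightarrow> zip k \<sigma>)) *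
        prod_list (map (signed_coord u) (case a of (\<sigma>, k) \<Rightarrow> zip k \<sigma>)) =
      (case a of (\<sigma>, k) \<Rightarrow> C \<sigma> k * (\<Prod>j<q. sign_conj (\<sigma> ! j) (u (k ! j))))"
      using len by simp
  next
    fix xs assume xs: "xs \<in> tuples (signed_modes M) q"
    then show "(map snd xs, map fst xs) \<in> sign_tuples q \<times> mode_tuples M q"
      by (simp add: map_fst_snd_in_tuples)
    show "(case (map snd xs, map fst xs) of (\<sigma>, k) \<Rightarrow> zip k \<sigma>) = xs"
      by (simp add: zip_map_fst_snd)
  qed
  finally show ?thesis .
qed

lemma coeff_family_symmetric:
  assumes "is_coeff_family M q P C"
  shows "symmetric_on (tuples (signed_modes M) q) (\<lambda>xs. C (map snd xs) (map fst xs))"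
  unfolding symmetric_on_def
proof (intro ballI allI impI)
  fix xs ys :: "(idx \<times> int) list"
  assume xs: "xs \<in> tuples (signed_modes M) q" and "mset ys = mset xs"
  then obtain p where p: "p permutes {..<length xs}" "permute_list p xs = ys"
    by (metis mset_eq_permutation)
  have len: "length xs = q" using xs by (simp add: tuples_def)
  have "ys = permute_list p (zip (map fst xs) (map snd xs))"
    by (simp add: zip_map_fst_snd p(2))
  also have "\<dots> = zip (permute_list p (map fst xs)) (permute_list p (map snd xs))"
    by (rule permute_list_zip[OF p(1)]) auto
  finally have "map snd ys = permute_list p (map snd xs)" "map fst ys = permute_list p (map fst xs)"
    by (auto simp: map_fst_zip map_snd_zip)
  moreover have "C (permute_list p (map snd xs)) (permute_list p (map fst xs)) = C (map snd xs) (map fst xs)"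
    using assms p(1) map_fst_snd_in_tuples[OF xs] unfolding is_coeff_family_def len by blast
  ultimately show "C (map snd ys) (map fst ys) = C (map snd xs) (map fst xs)" by simp
qed

lemma coeff_family_conj:
  assumes "is_coeff_family M q P C" "xs \<in> tuples (signed_modes M) q"
  shows "C (map snd (map flip xs)) (map fst (map flip xs)) = cnj (C (map snd xs) (map fst xs))"
  unfolding map_flip_eq using assms map_fst_snd_in_tuples[OF assms(2)]
  unfolding is_coeff_family_def by blast

lemma coeff_family_form:
  assumes "is_coeff_family M q P C" "u \<in> states M"
  shows "of_real (P u) = form (signed_modes M) q (\<lambda>xs. C (map snd xs) (map fst xs)) (signed_coord u)"
  using assms unfolding is_coeff_family_def coefficient_sum_eq_form by blast

lemma coeff_family_unique:
  assumes "is_coeff_family M q P C" "is_coeff_family M q P C'"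
  shows "C = C'"
proof (intro ext)
  fix \<sigma> k
  show "C \<sigma> k = C' \<sigma> k"
  proof (cases "\<sigma> \<in> sign_tuples q \<and> k \<in> mode_tuples M q")
    case False
    then show ?thesis using assms unfolding is_coeff_family_def by metis
  next
    case True
    then have zip: "zip k \<sigma> \<in> tuples (signed_modes M) q" and len: "length \<sigma> = q" "length k = q"
      using zip_in_tuples by (auto simp: sign_tuples_def mode_tuples_def)
    have "C (map snd (zip k \<sigma>)) (map fst (zip k \<sigma>)) = C' (map snd (zip k \<sigma>)) (map fst (zip k \<sigma>))"
      by (rule symmetric_coeffs_unique[OF coeff_family_symmetric[OF assms(1)]
            coeff_family_symmetric[OF assms(2)] _ zip])
         (simp only: coeff_family_form[OF assms(1), symmetric] coeff_family_form[OF assms(2), symmetric])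
    then show ?thesis using len by simp
  qed
qed

text \<open>
  Conjugating a real polynomial gives a second symmetric representation of it, and the two agree
  by uniqueness. So the reality condition on coefficients never has to be verified by hand, in
  particular not for the Poisson bracket.
\<close>

lemma symmetric_coeffs_conj:
  assumes "symmetric_on (tuples (signed_modes M) q) c"
    and "\<And>u. u \<in> states M \<Longrightarrow> of_real (P u) = form (signed_modes M) q c (signed_coord u)"
    and "xs \<in> tuples (signed_modes M) q"
  shows "c (map flip xs) = cnj (c xs)"
proof -
  have "symmetric_on (tuples (signed_modes M) q) (\<lambda>xs. cnj (c (map flip xs)))"
    unfolding symmetric_on_def
  proof (intro ballI allI impI)
    fix xs ys :: "(idx \<times> int) list"
    assume "xs \<in> tuples (signed_modes M) q" "mset ys = mset xs"
    then show "cnj (c (map flip ys)) = cnj (c (map flip xs))"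
      using symmetric_onD[OF assms(1) map_flip_in_tuples, of xs "map flip ys"] by simp
  qed
  moreover have "form (signed_modes M) q (\<lambda>xs. cnj (c (map flip xs))) (signed_coord u) =
      form (signed_modes M) q c (signed_coord u)" if "u \<in> states M" for u
    unfolding cnj_form_signed_coord[symmetric] assms(2)[OF that, symmetric] by simp
  ultimately have "cnj (c (map flip xs)) = c xs"
    by (rule symmetric_coeffs_unique[OF _ assms(1) _ assms(3)])
  then have "cnj (cnj (c (map flip xs))) = cnj (c xs)" by (rule arg_cong)
  then show ?thesis by simp
qed

lemma coeff_family_of_symmetric:
  assumes sym: "symmetric_on (tuples (signed_modes M) q) c"
    and P: "\<And>u. u \<in> states M \<Longrightarrow> of_real (P u) = form (signed_modes M) q c (signed_coord u)"
  defines "C \<equiv> \<lambda>\<sigma> k. if \<sigma> \<in> sign_tuples q \<and> k \<in> mode_tuples M q then c (zip k \<sigma>) else 0"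
  shows "is_coeff_family M q P C"
proof -
  have 1: "C \<sigma> k = c (zip k \<sigma>)" if "\<sigma> \<in> sign_tuples q" "k \<in> mode_tuples M q" for \<sigma> k
    using that by (simp add: C_def)
  have 2: "C (map snd xs) (map fst xs) = c xs" if "xs \<in> tuples (signed_modes M) q" for xs
    using map_fst_snd_in_tuples[OF that] by (simp add: C_def zip_map_fst_snd)
  have neg: "map uminus \<sigma> \<in> sign_tuples q" if "\<sigma> \<in> sign_tuples q" for \<sigma>
    using that by (auto simp: sign_tuples_def)
  have "C (map uminus \<sigma>) k = cnj (C \<sigma> k)" if h: "\<sigma> \<in> sign_tuples q" "k \<in> mode_tuples M q" for \<sigma> k
  proof -
    have "map flip (zip k \<sigma>) = zip k (map uminus \<sigma>)"
      by (simp add: flip_def zip_map2 case_prod_unfold)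
    then show ?thesis
      using symmetric_coeffs_conj[OF sym P zip_in_tuples[OF h]] by (simp add: 1 h neg)
  qed
  moreover have "C (permute_list p \<sigma>) (permute_list p k) = C \<sigma> k"
    if h: "\<sigma> \<in> sign_tuples q" "k \<in> mode_tuples M q" and p: "p permutes {..<q}" for \<sigma> k p
  proof -
    have len: "length \<sigma> = q" "length k = q" using h by (auto simp: sign_tuples_def mode_tuples_def)
    have "permute_list p \<sigma> \<in> sign_tuples q" "permute_list p k \<in> mode_tuples M q"
      using h p len by (auto simp: sign_tuples_def mode_tuples_def)
    moreover have "zip (permute_list p k) (permute_list p \<sigma>) = permute_list p (zip k \<sigma>)"
      using p len by (intro permute_list_zip[symmetric]) auto
    moreover have "c (permute_list p (zip k \<sigma>)) = c (zip k \<sigma>)"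
      by (rule symmetric_onD[OF sym zip_in_tuples[OF h]], rule mset_permute_list) (use p len in auto)
    ultimately show ?thesis by (simp only: 1 h)
  qed
  moreover have "of_real (P u) = (\<Sum>\<sigma>\<in>sign_tuples q. \<Sum>k\<in>mode_tuples M q.
      C \<sigma> k * (\<Prod>j<q. sign_conj (\<sigma> ! j) (u (k ! j))))" if "u \<in> states M" for u
    unfolding coefficient_sum_eq_form P[OF that] by (rule form_cong) (simp_all add: 2)
  moreover have "C \<sigma> k = 0" if "\<not> (\<sigma> \<in> sign_tuples q \<and> k \<in> mode_tuples M q)" for \<sigma> k
    using that unfolding C_def by (rule if_not_P)
  ultimately show ?thesis
    unfolding is_coeff_family_def by (intro conjI ballI allI impI)
qed

lemma poly_coeff_eqI:
  assumes "symmetric_on (tuples (signed_modes M) q) c"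
    and "\<And>u. u \<in> states M \<Longrightarrow> of_real (P u) = form (signed_modes M) q c (signed_coord u)"
    and "\<sigma> \<in> sign_tuples q" "k \<in> mode_tuples M q"
  shows "poly_coeff M q P \<sigma> k = c (zip k \<sigma>)"
proof -
  note fam = coeff_family_of_symmetric[OF assms(1,2)]
  have "poly_coeff M q P = (\<lambda>\<sigma> k. if \<sigma> \<in> sign_tuples q \<and> k \<in> mode_tuples M q then c (zip k \<sigma>) else 0)"
    unfolding poly_coeff_def using fam coeff_family_unique by (intro the_equality) blast+
  then show ?thesis using assms(3,4) by simp
qed

lemma real_monomials_form:
  "of_real (\<Sum>xs | set xs \<subseteq> modes M \<times> UNIV \<and> length xs = q. a xs * (\<Prod>j<q. real_coord u (xs ! j))) =
    form (modes M \<times> UNIV) q (\<lambda>xs. of_real (a xs)) (\<lambda>x. of_real (real_coord u x))"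
proof -
  have "of_real (\<Prod>j<q. real_coord u (xs ! j)) = prod_list (map (\<lambda>x. complex_of_real (real_coord u x)) xs)"
    if "length xs = q" for xs
    using that by (simp add: prod.list_conv_set_nth atLeast0LessThan)
  then show ?thesis by (simp add: form_def tuples_def)
qed

text \<open>
  Being a real homogeneous polynomial in real and imaginary parts is the same as being a real-valued
  form in \<open>u\<close> and its conjugate: both directions are linear changes of coordinates, and in the
  second one the imaginary parts of the resulting coefficients can be dropped because the value is
  real.
\<close>

lemma homogeneous_polys_iff_form:
  "P \<in> homogeneous_polys M q \<longleftrightarrow>
    (\<exists>c. \<forall>u\<in>states M. of_real (P u) = form (signed_modes M) q c (signed_coord u))"
proof
  assume "P \<in> homogeneous_polys M q"
  then obtain a where a: "\<And>u. u \<in> states M \<Longrightarrow> of_real (P u) =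
      form (modes M \<times> UNIV) q (\<lambda>xs. of_real (a xs)) (\<lambda>x. of_real (real_coord u x))"
    unfolding homogeneous_polys_def real_monomials_form[symmetric] of_real_eq_iff by blast
  \<comment> \<open>\<open>Re z = (z + cnj z) / 2\<close> and \<open>Im z = - \<i> (z - cnj z) / 2\<close>.\<close>
  define \<alpha> :: "idx \<times> bool \<Rightarrow> idx \<times> int \<Rightarrow> complex" where
    "\<alpha> = (\<lambda>x y. if fst y = fst x then (if snd x then 1 / 2 else - \<i> * of_int (snd y) / 2) else 0)"
  have "of_real (real_coord u x) = (\<Sum>y\<in>signed_modes M. \<alpha> x y * signed_coord u y)"
    if "x \<in> modes M \<times> UNIV" for u x
  proof -
    have "(\<Sum>y\<in>signed_modes M. \<alpha> x y * signed_coord u y) =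
      (\<Sum>k\<in>modes M. if k = fst x then of_real (real_coord u x) else 0)"
      unfolding sum_signed_modes
      by (rule sum.cong) (auto simp: \<alpha>_def real_coord_def complex_eq_iff)
    then show ?thesis using that by auto
  qed
  note change = form_linear_change[where A = "modes M \<times> UNIV", OF this]
  show "\<exists>c. \<forall>u\<in>states M. of_real (P u) = form (signed_modes M) q c (signed_coord u)"
    by (intro exI ballI) (simp only: a change)
next
  assume "\<exists>c. \<forall>u\<in>states M. of_real (P u) = form (signed_modes M) q c (signed_coord u)"
  then obtain c where c: "\<And>u. u \<in> states M \<Longrightarrow> of_real (P u) = form (signed_modes M) q c (signed_coord u)"
    by blast
  define \<beta> :: "idx \<times> int \<Rightarrow> idx \<times> bool \<Rightarrow> complex" where
    "\<beta> = (\<lambda>x y. if fst y = fst x then (if snd y then 1 else of_int (snd x) * \<i>) else 0)"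
  have "signed_coord u x = (\<Sum>y\<in>modes M \<times> UNIV. \<beta> x y * of_real (real_coord u y))"
    if "x \<in> signed_modes M" for u x
  proof -
    have "(\<Sum>y\<in>modes M \<times> UNIV. \<beta> x y * of_real (real_coord u y)) =
      (\<Sum>k\<in>modes M. \<Sum>b\<in>UNIV. \<beta> x (k, b) * of_real (real_coord u (k, b)))"
      by (simp only: sum.cartesian_product case_prod_unfold prod.collapse)
    also have "\<dots> = (\<Sum>k\<in>modes M. if k = fst x then signed_coord u x else 0)"
      by (rule sum.cong)
         (use that in \<open>auto simp: \<beta>_def real_coord_def UNIV_bool complex_eq_iff signed_modes_def signed_coord_def sign_conj_def\<close>)
    finally show ?thesis using that by (auto simp: signed_modes_def)
  qed
  note change = form_linear_change[where A = "signed_modes M", OF this]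
  have "\<exists>d. \<forall>u\<in>states M. of_real (P u) = form (modes M \<times> UNIV) q d (\<lambda>x. of_real (real_coord u x))"
    by (intro exI ballI) (rule trans[OF c change])
  then obtain d where d: "\<And>u. u \<in> states M \<Longrightarrow>
      of_real (P u) = form (modes M \<times> UNIV) q d (\<lambda>x. of_real (real_coord u x))"
    by blast
  have "of_real (P u) = form (modes M \<times> UNIV) q (\<lambda>xs. of_real (Re (d xs))) (\<lambda>x. of_real (real_coord u x))"
    if "u \<in> states M" for u
  proof -
    have prod: "prod_list (map (\<lambda>x. complex_of_real (real_coord u x)) xs) = of_real (prod_list (map (real_coord u) xs))" for xs
      by (induction xs) auto
    have "P u = Re (of_real (P u))" by simp
    also have "\<dots> = Re (form (modes M \<times> UNIV) q (\<lambda>xs. of_real (Re (d xs))) (\<lambda>x. of_real (real_coord u x)))"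
      unfolding d[OF that] form_def prod by simp
    also have "complex_of_real \<dots> = form (modes M \<times> UNIV) q (\<lambda>xs. of_real (Re (d xs))) (\<lambda>x. of_real (real_coord u x))"
      unfolding form_def prod by (simp add: complex_eq_iff)
    finally show ?thesis .
  qed
  then show "P \<in> homogeneous_polys M q"
    unfolding homogeneous_polys_def real_monomials_form[symmetric] of_real_eq_iff
    by (intro CollectI exI ballI)
qed

lemma poly_coeff_family:
  assumes "P \<in> homogeneous_polys M q"
  shows "is_coeff_family M q P (poly_coeff M q P)"
proof -
  obtain c where c: "\<And>u. u \<in> states M \<Longrightarrow> of_real (P u) = form (signed_modes M) q c (signed_coord u)"
    using assms unfolding homogeneous_polys_iff_form by blast
  have "\<exists>C. is_coeff_family M q P C"
    by (rule exI, rule coeff_family_of_symmetric[OF symmetric_on_symmetrize[of _ c]])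
       (subst form_symmetrize, auto intro: c)
  then have "\<exists>!C. is_coeff_family M q P C" using coeff_family_unique by blast
  then show ?thesis unfolding poly_coeff_def by (rule theI')
qed

section \<open>Weights and norms\<close>

abbreviation mode_size :: "idx \<Rightarrow> real" where
  "mode_size k \<equiv> jap (real (fst k))"

lemma jap_ge_1: "1 \<le> jap y"
  by (simp add: jap_def)

lemma jap_pos: "0 < jap y"
  using jap_ge_1[of y] by linarith

lemma abs_le_jap: "\<bar>y\<bar> \<le> jap y"
  unfolding jap_def by (rule real_le_rsqrt) simp

lemma lone_entry_iff_count:
  "(\<exists>j<length ks. ks ! j = x \<and> (\<forall>j'<length ks. j' \<noteq> j \<longrightarrow> ks ! j' \<noteq> ks ! j)) \<longleftrightarrow> count (mset ks) x = 1"
proof -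
  have "count (mset ks) x = card {j. j < length ks \<and> ks ! j = x}"
    by (simp add: count_mset count_list_eq_length_filter length_filter_conv_card eq_commute)
  then have "count (mset ks) x = 1 \<longleftrightarrow> (\<exists>j. {j. j < length ks \<and> ks ! j = x} = {j})"
    by (simp add: card_1_singleton_iff)
  moreover have "{i. i < length ks \<and> ks ! i = x} = {j} \<longleftrightarrow>
      j < length ks \<and> ks ! j = x \<and> (\<forall>i<length ks. i \<noteq> j \<longrightarrow> ks ! i \<noteq> ks ! j)" for j
  proof -
    have "{i. R i} = {j} \<longleftrightarrow> R j \<and> (\<forall>i. R i \<longrightarrow> i = j)" for R :: "nat \<Rightarrow> bool"
      by auto
    then show ?thesis by auto
  qed
  ultimately show ?thesis by (simp only: conj_assoc)
qed

text \<open>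
  In this form the weight visibly depends on the multiset of modes alone.
\<close>

lemma Upsilon_eq_Max_count: "Upsilon ks = Max (insert 1 (mode_size ` {x. count (mset ks) x = 1}))"
proof -
  have "{mode_size (ks ! j) | j. j < length ks \<and> (\<forall>j'<length ks. j' \<noteq> j \<longrightarrow> ks ! j' \<noteq> ks ! j)} =
    mode_size ` {x. count (mset ks) x = 1}"
    unfolding lone_entry_iff_count[symmetric] by blast
  then show ?thesis by (simp add: Upsilon_def)
qed

lemma finite_lone_entries: "finite {x. count (mset ks) x = 1}"
  by (rule finite_subset[of _ "set ks"]) (auto simp flip: count_greater_zero_iff set_mset_mset)

lemma Upsilon_ge_1: "1 \<le> Upsilon ks"
  unfolding Upsilon_eq_Max_count using finite_lone_entries by (intro Max_ge) auto

lemma mode_size_le_Upsilon: "count (mset ks) x = 1 \<Longrightarrow> mode_size x \<le> Upsilon ks"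
  unfolding Upsilon_eq_Max_count using finite_lone_entries by (intro Max_ge) auto

lemma Upsilon_leI:
  assumes "1 \<le> B" "\<And>x. count (mset ks) x = 1 \<Longrightarrow> mode_size x \<le> B"
  shows "Upsilon ks \<le> B"
  unfolding Upsilon_eq_Max_count using finite_lone_entries assms by (subst Max_le_iff) auto

lemma Upsilon_mset_cong: "mset ks = mset ks' \<Longrightarrow> Upsilon ks = Upsilon ks'"
  by (simp add: Upsilon_eq_Max_count)

text \<open>
  An entry that is lone in \<open>xs @ ys\<close> lies in only one of the two lists, and it stays lone
  when \<open>k\<close> is put in front, unless it is \<open>k\<close> itself.
\<close>

lemma Upsilon_append_le:
  "Upsilon (xs @ ys) \<le> max (max (Upsilon (k # xs)) (Upsilon (k # ys))) (mode_size k)"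
proof (rule Upsilon_leI)
  fix x assume "count (mset (xs @ ys)) x = 1"
  then have "x = k \<or> count (mset (k # xs)) x = 1 \<or> count (mset (k # ys)) x = 1"
    by (auto simp: add_is_1)
  then show "mode_size x \<le> max (max (Upsilon (k # xs)) (Upsilon (k # ys))) (mode_size k)"
    using mode_size_le_Upsilon by (metis max.cobounded2 max.coboundedI1 max.cobounded1 order_trans)
qed (use Upsilon_ge_1[of "k # xs"] in auto)

lemma Upsilon_append_le_product:
  "Upsilon (xs @ ys) \<le> (mode_size k)\<^sup>2 * Upsilon (k # xs) * Upsilon (k # ys)"
proof -
  define a b c where "a = Upsilon (k # xs)" "b = Upsilon (k # ys)" "c = mode_size k"
  have ge: "1 \<le> a" "1 \<le> b" "1 \<le> c"
    by (simp_all add: a_b_c_def Upsilon_ge_1 jap_ge_1)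
  have "1 \<le> a * b" "1 \<le> c\<^sup>2" "c \<le> c\<^sup>2"
    using mult_mono[of 1 a 1 b] mult_mono[of 1 c 1 c] mult_mono[of 1 c c c] ge
    by (auto simp: power2_eq_square)
  moreover have "a \<le> a * b" "b \<le> a * b"
    using mult_left_mono[of 1 b a] mult_right_mono[of 1 a b] ge by auto
  moreover have "c\<^sup>2 \<le> c\<^sup>2 * (a * b)" "a * b \<le> c\<^sup>2 * (a * b)"
    using mult_left_mono[of 1 "a * b" "c\<^sup>2"] mult_right_mono[of 1 "c\<^sup>2" "a * b"] calculation by auto
  ultimately have "max (max a b) c \<le> c\<^sup>2 * (a * b)" by linarith
  then show ?thesis
    unfolding a_b_c_def mult.assoc[symmetric] by (rule order_trans[OF Upsilon_append_le])
qed

text \<open>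
  If \<open>k\<close> is a new mode, it is lone in \<open>k # xs\<close>, so the first weight already
  dominates the size of \<open>k\<close> and the prefactor of the previous estimate disappears.
\<close>

lemma Upsilon_append_le_product_fresh:
  assumes "k \<notin> set (xs @ ys)"
  shows "Upsilon (xs @ ys) \<le> Upsilon (k # xs) * Upsilon (k # ys)"
proof -
  define a b c where "a = Upsilon (k # xs)" "b = Upsilon (k # ys)" "c = mode_size k"
  have "count (mset (k # xs)) k = 1" "count (mset (k # ys)) k = 1"
    using assms by (simp_all add: count_eq_zero_iff)
  then have "c \<le> a" by (auto simp: a_b_c_def intro: mode_size_le_Upsilon)
  have ge: "1 \<le> a" "1 \<le> b"
    by (simp_all add: a_b_c_def Upsilon_ge_1)
  have "a \<le> a * b" "b \<le> a * b"
    using mult_left_mono[of 1 b a] mult_right_mono[of 1 a b] ge by auto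
  with \<open>c \<le> a\<close> have "max (max a b) c \<le> a * b" by linarith
  then show ?thesis
    unfolding a_b_c_def by (rule order_trans[OF Upsilon_append_le])
qed

definition mode_weight :: "(idx \<times> int) list \<Rightarrow> real" where
  "mode_weight xs = sqrt (\<Prod>x\<leftarrow>xs. mode_size (fst x))"

definition lone_weight :: "(idx \<times> int) list \<Rightarrow> real" where
  "lone_weight xs = sqrt (Upsilon (map fst xs))"

definition phase :: "(idx \<times> int) list \<Rightarrow> int" where
  "phase xs = (\<Sum>x\<leftarrow>xs. snd x * int (fst (fst x)))"

lemma mode_weight_pos: "0 < mode_weight xs"
  unfolding mode_weight_def by (induction xs) (auto simp: jap_pos)

lemma lone_weight_pos: "0 < lone_weight xs"
  unfolding lone_weight_def using Upsilon_ge_1[of "map fst xs"] by simp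

lemma mode_weight_Cons: "mode_weight (x # xs) = sqrt (mode_size (fst x)) * mode_weight xs"
  by (simp add: mode_weight_def real_sqrt_mult)

lemma mode_weight_append: "mode_weight (xs @ ys) = mode_weight xs * mode_weight ys"
  by (simp add: mode_weight_def real_sqrt_mult)

lemma weights_mset_cong:
  assumes "mset xs = mset ys"
  shows "mode_weight xs = mode_weight ys" "lone_weight xs = lone_weight ys"
  using assms prod_list_map_mset_cong[OF assms] Upsilon_mset_cong[of "map fst xs" "map fst ys"]
  by (simp_all add: mode_weight_def lone_weight_def)

lemma finite_sign_mode_tuples: "finite (sign_tuples q \<times> mode_tuples M q)"
  unfolding sign_tuples_def mode_tuples_def by (simp add: finite_lists_length_eq)

lemma sign_mode_tuples_nonempty:
  assumes "0 \<le> M" shows "sign_tuples q \<times> mode_tuples M q \<noteq> {}"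
proof -
  have "(replicate q 1, replicate q (0, 0)) \<in> sign_tuples q \<times> mode_tuples M q"
    using assms by (auto simp: sign_tuples_def mode_tuples_def modes_def)
  then show ?thesis by blast
qed

lemma weights_index:
  assumes "length xs = q"
  shows "sqrt (\<Prod>j<q. mode_size (map fst xs ! j)) = mode_weight xs"
    and "(\<Sum>j<q. map snd xs ! j * int (fst (map fst xs ! j))) = phase xs"
proof -
  have "(\<Prod>j<q. mode_size (map fst xs ! j)) = (\<Prod>x\<leftarrow>xs. mode_size (fst x))"
    using assms by (simp add: prod.list_conv_set_nth atLeast0LessThan)
  then show "sqrt (\<Prod>j<q. mode_size (map fst xs ! j)) = mode_weight xs"
    by (simp only: mode_weight_def)
  show "(\<Sum>j<q. map snd xs ! j * int (fst (map fst xs ! j))) = phase xs"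
    using assms by (simp add: phase_def sum.list_conv_set_nth atLeast0LessThan)
qed

lemma coeff_le_norm_H:
  assumes "xs \<in> tuples (signed_modes M) q"
  shows "cmod (poly_coeff M q P (map snd xs) (map fst xs)) * mode_weight xs * lone_weight xs \<le> norm_H M q P"
proof -
  have len: "length xs = q" using assms by (simp add: tuples_def)
  show ?thesis
    unfolding norm_H_def weights_index(1)[OF len, symmetric] lone_weight_def
    by (rule Max_ge[OF finite_imageI[OF finite_sign_mode_tuples]])
       (use map_fst_snd_in_tuples[OF assms] in \<open>force\<close>)
qed

lemma coeff_le_norm_C:
  assumes "xs \<in> tuples (signed_modes M) q"
  shows "cmod (poly_coeff M q P (map snd xs) (map fst xs)) * jap (of_int (phase xs)) *
    mode_weight xs * lone_weight xs \<le> norm_C M q P"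
proof -
  have len: "length xs = q" using assms by (simp add: tuples_def)
  show ?thesis
    unfolding norm_C_def weights_index[OF len, symmetric] lone_weight_def
    by (rule Max_ge[OF finite_imageI[OF finite_sign_mode_tuples]])
       (use map_fst_snd_in_tuples[OF assms] in \<open>force\<close>)
qed

lemma norm_H_leI:
  assumes "0 \<le> M"
    and "\<And>xs. xs \<in> tuples (signed_modes M) q \<Longrightarrow>
      cmod (poly_coeff M q P (map snd xs) (map fst xs)) * mode_weight xs * lone_weight xs \<le> B"
  shows "norm_H M q P \<le> B"
  unfolding norm_H_def
proof (subst Max_le_iff)
  show "\<forall>a\<in>(\<lambda>(\<sigma>, k). cmod (poly_coeff M q P \<sigma> k) * sqrt (\<Prod>j<q. mode_size (k ! j)) * sqrt (Upsilon k)) `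
      (sign_tuples q \<times> mode_tuples M q). a \<le> B"
  proof clarify
    fix \<sigma> k assume h: "\<sigma> \<in> sign_tuples q" "k \<in> mode_tuples M q"
    then have len: "length \<sigma> = q" "length k = q" by (auto simp: sign_tuples_def mode_tuples_def)
    then have zip: "map fst (zip k \<sigma>) = k" "map snd (zip k \<sigma>) = \<sigma>" "length (zip k \<sigma>) = q" by auto
    show "cmod (poly_coeff M q P \<sigma> k) * sqrt (\<Prod>j<q. mode_size (k ! j)) * sqrt (Upsilon k) \<le> B"
      using assms(2)[OF zip_in_tuples[OF h]]
      unfolding weights_index(1)[OF zip(3), symmetric] lone_weight_def zip .
  qed
qed (use assms(1) sign_mode_tuples_nonempty finite_sign_mode_tuples in auto)

section \<open>The logarithmic sum over intermediate modes\<close>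

lemma harmonic_sum_le: "1 \<le> n \<Longrightarrow> (\<Sum>j=1..n. 1 / real j) \<le> 1 + ln (real n)"
proof (induction n rule: dec_induct)
  case (step n)
  have "ln (real n / real (Suc n)) \<le> real n / real (Suc n) - 1"
    using step by (intro ln_le_minus_one) auto
  then have "1 / real (Suc n) \<le> ln (real (Suc n)) - ln (real n)"
    using step by (simp add: ln_div field_simps)
  with step show ?case by simp
qed simp

lemma sum_inverse_jap_symmetric_le:
  assumes "1 \<le> n"
  shows "(\<Sum>j\<in>{- int n..int n}. 1 / jap (of_int j)) \<le> 3 + 2 * ln (real n)"
proof -
  have "{- int n..int n} = insert 0 ({1..int n} \<union> {- int n..-1})" by auto
  then have "(\<Sum>j\<in>{- int n..int n}. 1 / jap (of_int j)) =
      1 / jap 0 + ((\<Sum>j\<in>{1..int n}. 1 / jap (of_int j)) + (\<Sum>j\<in>{- int n..-1}. 1 / jap (of_int j)))"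
    by (simp add: sum.union_disjoint)
  also have "(\<Sum>j\<in>{- int n..-1}. 1 / jap (of_int j)) = (\<Sum>j\<in>{1..int n}. 1 / jap (of_int j))"
    by (rule sum.reindex_bij_witness[where i = uminus and j = uminus]) (auto simp: jap_def)
  also have "(\<Sum>j\<in>{1..int n}. 1 / jap (of_int j)) = (\<Sum>j=1..n. 1 / jap (real j))"
    by (rule sum.reindex_bij_witness[where i = int and j = nat]) auto
  also have "(\<Sum>j=1..n. 1 / jap (real j)) \<le> (\<Sum>j=1..n. 1 / real j)"
    using abs_le_jap[of "real _"] by (intro sum_mono divide_left_mono) (auto simp: jap_pos)
  also have "\<dots> \<le> 1 + ln (real n)" by (rule harmonic_sum_le[OF assms])
  also have "1 / jap 0 = 1" by (simp add: jap_def)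
  finally show ?thesis by simp
qed

text \<open>
  The points \<open>s * l + p\<close> are distinct integers. Those inside \<open>{- n..n}\<close> contribute at
  most a harmonic sum, wherever \<open>p\<close> lies, and each of the at most \<open>n + 1\<close> others
  contributes at most \<open>1 / (n + 1)\<close>.
\<close>

lemma sum_inverse_jap_shift_le:
  assumes "1 \<le> n" "s \<in> {-1, 1}"
  shows "(\<Sum>l\<le>n. 1 / jap (of_int (s * int l + p))) \<le> 5 + 2 * ln (real n)"
proof -
  define S where "S = (\<lambda>l. s * int l + p) ` {..n}"
  have inj: "inj_on (\<lambda>l. s * int l + p) {..n}" using assms(2) by (auto simp: inj_on_def)
  have card: "card S = n + 1" by (simp add: S_def card_image[OF inj])
  have fin: "finite S" by (simp add: S_def)
  have "(\<Sum>l\<le>n. 1 / jap (of_int (s * int l + p))) = (\<Sum>j\<in>S. 1 / jap (of_int j))"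
    by (simp add: S_def sum.reindex[OF inj])
  also have "\<dots> = (\<Sum>j\<in>S \<inter> {- int n..int n}. 1 / jap (of_int j)) + (\<Sum>j\<in>S - {- int n..int n}. 1 / jap (of_int j))"
    by (rule sum.Int_Diff[OF fin])
  also have "(\<Sum>j\<in>S \<inter> {- int n..int n}. 1 / jap (of_int j)) \<le> (\<Sum>j\<in>{- int n..int n}. 1 / jap (of_int j))"
    by (rule sum_mono2) (auto simp: jap_pos less_imp_le)
  also have "\<dots> \<le> 3 + 2 * ln (real n)" by (rule sum_inverse_jap_symmetric_le[OF assms(1)])
  also have "(\<Sum>j\<in>S - {- int n..int n}. 1 / jap (of_int j)) \<le> of_nat (card (S - {- int n..int n})) * (1 / (real n + 1))"
  proof (rule sum_bounded_above)
    fix j assume "j \<in> S - {- int n..int n}"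
    then have "int n + 1 \<le> \<bar>j\<bar>" by auto
    then have "real n + 1 \<le> \<bar>real_of_int j\<bar>" by linarith
    with abs_le_jap[of "real_of_int j"] show "1 / jap (of_int j) \<le> 1 / (real n + 1)"
      by (intro divide_left_mono) (auto simp: jap_pos)
  qed
  also have "\<dots> \<le> (real n + 1) * (1 / (real n + 1))"
    using card_mono[OF fin, of "S - {- int n..int n}"] card by (intro mult_right_mono) auto
  finally show ?thesis by simp
qed

lemma ln_ge_half:
  fixes M :: real
  assumes "2 \<le> M" shows "1 / 2 \<le> ln M"
proof -
  have "1 / 2 \<le> ln (2 :: real)"
    using ln_le_minus_one[of "1 / 2 :: real"] by (simp add: ln_div)
  also have "\<dots> \<le> ln M" using assms by simp
  finally show ?thesis .
qed

text \<open>
  The \<open>2 l + 1\<close> modes of degree \<open>l\<close> are paid for by the factor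
  \<open>1 / mode_size k\<close>; what remains is a harmonic sum in \<open>l\<close>, the source of the
  logarithm.
\<close>

lemma sum_modes_inverse_le:
  assumes M: "2 \<le> M" and s: "s \<in> {-1, 1}"
  shows "(\<Sum>k\<in>modes M. 1 / (jap (of_int (s * int (fst k) + p)) * mode_size k)) \<le> 36 * ln M"
proof -
  define n where "n = nat \<lfloor>M\<rfloor>"
  have n: "1 \<le> n" "real n \<le> M" using M by (auto simp: n_def le_nat_iff le_floor_iff)
  have modes: "modes M = (SIGMA l:{..n}. {- int l..int l})" using M by (simp add: modes_eq n_def)
  have "(\<Sum>k\<in>modes M. 1 / (jap (of_int (s * int (fst k) + p)) * mode_size k)) =
    (\<Sum>l\<le>n. (2 * real l + 1) * (1 / (jap (of_int (s * int l + p)) * jap (real l))))"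
    unfolding modes by (subst sum.Sigma[symmetric, unfolded case_prod_unfold]) (simp_all add: nat_add_distrib nat_mult_distrib add.commute)
  also have "\<dots> \<le> (\<Sum>l\<le>n. 3 * (1 / jap (of_int (s * int l + p))))"
  proof (rule sum_mono)
    fix l
    have "(2 * real l + 1) / jap (real l) \<le> 3"
      using abs_le_jap[of "real l"] jap_ge_1[of "real l"] by (simp add: divide_le_eq)
    then have "(2 * real l + 1) / jap (real l) * (1 / jap (of_int (s * int l + p))) \<le>
        3 * (1 / jap (of_int (s * int l + p)))"
      by (rule mult_right_mono) (simp add: jap_pos less_imp_le)
    then show "(2 * real l + 1) * (1 / (jap (of_int (s * int l + p)) * jap (real l))) \<le>
        3 * (1 / jap (of_int (s * int l + p)))"
      by (simp add: mult.commute)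
  qed
  also have "\<dots> = 3 * (\<Sum>l\<le>n. 1 / jap (of_int (s * int l + p)))"
    by (simp only: sum_distrib_left)
  also have "\<dots> \<le> 3 * (5 + 2 * ln (real n))"
    using sum_inverse_jap_shift_le[OF n(1) s] by (intro mult_left_mono) auto
  also have "\<dots> \<le> 3 * (12 * ln M)"
  proof -
    have "ln (real n) \<le> ln M" using n M by simp
    moreover have "3 * (5 + 2 * a) \<le> 3 * (12 * b)" if "a \<le> b" "1 / 2 \<le> b" for a b :: real
      using that by simp
    ultimately show ?thesis using ln_ge_half[OF M] by blast
  qed
  finally show ?thesis by simp
qed

section \<open>The bracket as a polynomial\<close>

text \<open>
  The contraction of the two coefficient families over one entry, with opposite signs on the two
  sides. The first \<open>r - 1\<close> entries of the list come from the first polynomial, the others from the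
  second, so the family is not symmetric.
\<close>

definition bracket_coeff ::
  "real \<Rightarrow> nat \<Rightarrow> nat \<Rightarrow> ((idx \<times> int) list \<Rightarrow> complex) \<Rightarrow> ((idx \<times> int) list \<Rightarrow> complex) \<Rightarrow>
    (idx \<times> int) list \<Rightarrow> complex" where
  "bracket_coeff M r r' c c' zs = (\<Sum>x\<in>signed_modes M.
     - (2 * \<i> * of_nat (r * r') * of_int (snd x)) *
     (c (x # take (r - 1) zs) * c' (flip x # drop (r - 1) zs)))"

text \<open>
  The bracket is the real part of \<open>4 \<i> r r'\<close> times a sum of products of a conjugate
  derivative of \<open>F\<close> and a derivative of \<open>G\<close>; writing the real part as half the sum with the
  conjugate produces the two signs of the contraction.
\<close>

lemma poisson_bracket_form:
  assumes c: "symmetric_on (tuples (signed_modes M) r) c"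
      "\<And>xs. xs \<in> tuples (signed_modes M) r \<Longrightarrow> c (map flip xs) = cnj (c xs)"
      "\<And>u. u \<in> states M \<Longrightarrow> of_real (F u) = form (signed_modes M) r c (signed_coord u)"
    and c': "symmetric_on (tuples (signed_modes M) r') c'"
      "\<And>xs. xs \<in> tuples (signed_modes M) r' \<Longrightarrow> c' (map flip xs) = cnj (c' xs)"
      "\<And>u. u \<in> states M \<Longrightarrow> of_real (G u) = form (signed_modes M) r' c' (signed_coord u)"
    and r: "1 \<le> r" "1 \<le> r'" and u: "u \<in> states M"
  shows "of_real (poisson_bracket M F G u) =
    form (signed_modes M) (r + r' - 2) (bracket_coeff M r r' c c') (signed_coord u)"
proof -
  let ?A = "signed_modes M"
  define f where "f x = form ?A (r - 1) (\<lambda>xs. c (x # xs)) (signed_coord u)" for x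
  define g where "g x = form ?A (r' - 1) (\<lambda>xs. c' (x # xs)) (signed_coord u)" for x
  have f: "cnj (f (k, -1)) = f (k, 1)" and g: "cnj (g (k, -1)) = g (k, 1)" if "k \<in> modes M" for k
    unfolding f_def g_def
    using cnj_form_partial[where c = c and q = r, OF c(2) r(1) that]
      cnj_form_partial[where c = c' and q = r', OF c'(2) r(2) that] by blast+
  have split: "r + r' - 2 = (r - 1) + (r' - 1)" using r by simp
  have grad: "gradient M F u = polynomial_gradient M r c u" "gradient M G u = polynomial_gradient M r' c' u"
    by (rule gradient_polynomial; fact c c' r u)+
  have "poisson_bracket M F G u =
      (\<Sum>k\<in>modes M. Re (\<i> * (2 * of_nat r * f (k, -1)) * cnj (2 * of_nat r' * g (k, -1))))"
    unfolding poisson_bracket_def l2_inner_def Re_sum grad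
    by (rule sum.cong) (simp_all add: polynomial_gradient_def f_def g_def)
  also have "of_real \<dots> = (\<Sum>k\<in>modes M. 2 * \<i> * of_nat (r * r') * (f (k, -1) * g (k, 1) - f (k, 1) * g (k, -1)))"
    unfolding of_real_sum
  proof (rule sum.cong)
    fix k assume k: "k \<in> modes M"
    have Re_eq: "complex_of_real (Re z) = (z + cnj z) / 2" for z
      by (simp add: complex_eq_iff)
    show "of_real (Re (\<i> * (2 * of_nat r * f (k, -1)) * cnj (2 * of_nat r' * g (k, -1)))) =
        2 * \<i> * of_nat (r * r') * (f (k, -1) * g (k, 1) - f (k, 1) * g (k, -1))"
      using f[OF k, symmetric] g[OF k, symmetric] unfolding Re_eq by (simp add: field_simps)
  qed simp
  also have "\<dots> = (\<Sum>x\<in>?A. - (2 * \<i> * of_nat (r * r') * of_int (snd x)) * (f x * g (flip x)))"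
    unfolding sum_signed_modes by (rule sum.cong) (simp_all add: flip_def algebra_simps)
  also have "\<dots> = form ?A (r + r' - 2) (bracket_coeff M r r' c c') (signed_coord u)"
    unfolding bracket_coeff_def[abs_def] form_sum_coeffs f_def g_def form_mult split ..
  finally show ?thesis .
qed

section \<open>Estimating the contraction\<close>

text \<open>
  One term of the contraction over \<open>x\<close>. The contracted mode \<open>k = fst x\<close> occurs in both
  factors, which gains \<open>1 / mode_size k\<close>, and the bound on \<open>\<alpha>\<close> gains the
  reciprocal of the phase weight. The loss is the ratio of the lone weights. For a mode not in
  \<open>xs @ ys\<close> there is no loss, and the second summand suffices. Otherwise the loss is at most
  \<open>mode_size k\<close> and may use up the whole gain; the first summand pays for it, and it is nonzero for
  boundedly many modes only.
\<close>

lemma bracket_term_le: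
  fixes \<alpha> \<beta> B C :: real
  assumes nonneg: "0 \<le> \<alpha>" "0 \<le> \<beta>"
    and \<alpha>: "\<alpha> * jap (of_int (phase (x # xs))) * mode_weight (x # xs) * lone_weight (x # xs) \<le> B"
    and \<beta>: "\<beta> * mode_weight (flip x # ys) * lone_weight (flip x # ys) \<le> C"
  shows "\<alpha> * \<beta> * (mode_weight (xs @ ys) * lone_weight (xs @ ys)) \<le>
    B * C * ((if fst x \<in> fst ` set (xs @ ys) then 1 else 0) +
      1 / (jap (of_int (snd x * int (fst (fst x)) + phase xs)) * mode_size (fst x)))"
proof -
  define J where "J = jap (of_int (snd x * int (fst (fst x)) + phase xs))"
  define b where "b = mode_size (fst x)"
  define U0 U1 U2 where "U0 = lone_weight (xs @ ys)" "U1 = lone_weight (x # xs)" "U2 = lone_weight (flip x # ys)"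
  define X where "X = \<alpha> * \<beta> * mode_weight xs * mode_weight ys"
  have J: "1 \<le> J" and b: "1 \<le> b" by (simp_all add: J_def b_def jap_ge_1)
  have U: "0 < U0" "0 < U1" "0 < U2" by (simp_all add: U0_U1_U2_def lone_weight_pos)
  have X: "0 \<le> X"
    unfolding X_def using nonneg mode_weight_pos less_imp_le by (intro mult_nonneg_nonneg) blast+
  have phase: "phase (x # xs) = snd x * int (fst (fst x)) + phase xs" by (simp add: phase_def)
  have "(\<alpha> * jap (of_int (phase (x # xs))) * mode_weight (x # xs) * lone_weight (x # xs)) *
      (\<beta> * mode_weight (flip x # ys) * lone_weight (flip x # ys)) = X * (J * b * (U1 * U2))"
    using b unfolding phase mode_weight_Cons
    by (simp add: J_def X_def U0_U1_U2_def b_def flip_def abs_of_pos jap_pos)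
  moreover have "0 \<le> \<beta> * mode_weight (flip x # ys) * lone_weight (flip x # ys)"
    using nonneg mode_weight_pos lone_weight_pos less_imp_le by (intro mult_nonneg_nonneg) blast+
  moreover have "0 \<le> B"
  proof -
    have "0 \<le> \<alpha> * jap (of_int (phase (x # xs))) * mode_weight (x # xs) * lone_weight (x # xs)"
      using nonneg mode_weight_pos lone_weight_pos jap_pos less_imp_le by (intro mult_nonneg_nonneg) blast+
    with \<alpha> show ?thesis by linarith
  qed
  ultimately have main: "X * (J * b * (U1 * U2)) \<le> B * C"
    using mult_mono[OF \<alpha> \<beta>] by simp
  then have BC: "0 \<le> B * C"
    using X J b U by (intro order_trans[OF _ main]) (intro mult_nonneg_nonneg, auto)
  have lhs: "\<alpha> * \<beta> * (mode_weight (xs @ ys) * lone_weight (xs @ ys)) = X * U0"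
    by (simp add: X_def U0_U1_U2_def mode_weight_append)
  have U0: "U0 = sqrt (Upsilon (map fst xs @ map fst ys))"
    and U12: "U1 = sqrt (Upsilon (fst x # map fst xs))" "U2 = sqrt (Upsilon (fst x # map fst ys))"
    by (simp_all add: U0_U1_U2_def lone_weight_def flip_def)
  have tau: "0 \<le> 1 / (J * b)" using J b by simp
  show ?thesis
  proof (cases "fst x \<in> fst ` set (xs @ ys)")
    case True
    have "U0 \<le> sqrt (b\<^sup>2 * Upsilon (fst x # map fst xs) * Upsilon (fst x # map fst ys))"
      unfolding U0 b_def by (rule real_sqrt_le_mono) (rule Upsilon_append_le_product)
    also have "\<dots> = 1 * b * (U1 * U2)" using b by (simp add: U12 real_sqrt_mult)
    also have "\<dots> \<le> J * b * (U1 * U2)" using J b U by (intro mult_right_mono) auto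
    finally have "X * U0 \<le> X * (J * b * (U1 * U2))" using X by (rule mult_left_mono)
    also note main
    also have "B * C \<le> B * C * (1 + 1 / (J * b))" using mult_left_mono[of 1 "1 + 1 / (J * b)", OF _ BC] tau by simp
    finally show ?thesis using True by (simp only: lhs J_def b_def if_True)
  next
    case False
    then have "fst x \<notin> set (map fst xs @ map fst ys)" by auto
    then have "U0 \<le> sqrt (Upsilon (fst x # map fst xs) * Upsilon (fst x # map fst ys))"
      unfolding U0 by (intro real_sqrt_le_mono Upsilon_append_le_product_fresh)
    also have "\<dots> = U1 * U2" by (simp add: U12 real_sqrt_mult)
    finally have "X * U0 \<le> X * (U1 * U2)" using X by (rule mult_left_mono)
    also have "\<dots> = X * (J * b * (U1 * U2)) * (1 / (J * b))" using J b by simp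
    also have "\<dots> \<le> B * C * (1 / (J * b))" using main tau by (rule mult_right_mono)
    finally show ?thesis using False by (simp only: lhs J_def b_def if_False add_0)
  qed
qed

text \<open>
  The constants \<open>4 n\<close> and \<open>72\<close> come from the two signs of a mode, from
  \<open>1 \<le> 2 * ln M\<close>, and from twice the \<open>36\<close> of the logarithmic sum.
\<close>

lemma sum_resonance_weights_le:
  assumes M: "2 \<le> M" and S: "finite S" "card S \<le> n"
  shows "(\<Sum>x\<in>signed_modes M. (if fst x \<in> S then 1 else 0) +
      1 / (jap (of_int (snd x * int (fst (fst x)) + p)) * mode_size (fst x))) \<le> (4 * real n + 72) * ln M"
proof -
  have "(\<Sum>x\<in>signed_modes M. if fst x \<in> S then 1 else 0 :: real) = 2 * real (card (modes M \<inter> S))"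
    unfolding sum_signed_modes by (simp add: sum.If_cases flip: sum_distrib_left)
  also have "\<dots> \<le> 2 * real n"
    using S card_mono[of S "modes M \<inter> S"] by simp
  also have "\<dots> \<le> 2 * real n * (2 * ln M)"
    using ln_ge_half[OF M] mult_left_mono[of 1 "2 * ln M" "2 * real n"] by simp
  finally have 1: "(\<Sum>x\<in>signed_modes M. if fst x \<in> S then 1 else 0 :: real) \<le> 2 * real n * (2 * ln M)" .
  have "(\<Sum>x\<in>signed_modes M. 1 / (jap (of_int (snd x * int (fst (fst x)) + p)) * mode_size (fst x))) =
    (\<Sum>k\<in>modes M. 1 / (jap (of_int (1 * int (fst k) + p)) * mode_size k)) +
    (\<Sum>k\<in>modes M. 1 / (jap (of_int (-1 * int (fst k) + p)) * mode_size k))"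
    unfolding sum_signed_modes sum.distrib by simp
  also have "\<dots> \<le> 36 * ln M + 36 * ln M"
    by (intro add_mono sum_modes_inverse_le M) auto
  finally show ?thesis using 1 by (simp add: sum.distrib algebra_simps)
qed

lemma norm_bracket_coeff_le:
  assumes M: "2 \<le> M" and r: "1 \<le> r" "1 \<le> r'"
    and B: "\<And>xs. xs \<in> tuples (signed_modes M) r \<Longrightarrow>
      cmod (c xs) * jap (of_int (phase xs)) * mode_weight xs * lone_weight xs \<le> B"
    and C: "\<And>xs. xs \<in> tuples (signed_modes M) r' \<Longrightarrow>
      cmod (c' xs) * mode_weight xs * lone_weight xs \<le> C"
    and BC: "0 \<le> B * C"
    and zs: "zs \<in> tuples (signed_modes M) (r + r' - 2)"
  shows "cmod (bracket_coeff M r r' c c' zs) * (mode_weight zs * lone_weight zs) \<le>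
    2 * real (r * r') * (4 * real (r + r') + 72) * ln M * C * B"
proof -
  let ?A = "signed_modes M"
  define xs ys where "xs = take (r - 1) zs" and "ys = drop (r - 1) zs"
  have zs_eq: "zs = xs @ ys" by (simp add: xs_def ys_def)
  have len: "length zs = r + r' - 2" and sub: "set zs \<subseteq> ?A" using zs by (auto simp: tuples_def)
  have xs: "xs \<in> tuples ?A (r - 1)" and ys: "ys \<in> tuples ?A (r' - 1)"
    using len sub r set_take_subset[of "r - 1" zs] set_drop_subset[of "r - 1" zs]
    by (auto simp: tuples_def xs_def ys_def)
  define W where "W = mode_weight zs * lone_weight zs"
  have W: "0 \<le> W" by (simp add: W_def mode_weight_pos lone_weight_pos less_imp_le)
  define \<tau> where "\<tau> x = (if fst x \<in> fst ` set zs then 1 else 0) +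
      1 / (jap (of_int (snd x * int (fst (fst x)) + phase xs)) * mode_size (fst x))" for x :: "idx \<times> int"
  have term_le: "cmod (- (2 * \<i> * of_nat (r * r') * of_int (snd x)) * (c (x # xs) * c' (flip x # ys))) * W \<le>
      2 * real (r * r') * (B * C * \<tau> x)" if x: "x \<in> ?A" for x
  proof -
    have "x # xs \<in> tuples ?A (Suc (r - 1))" "flip x # ys \<in> tuples ?A (Suc (r' - 1))"
      using x xs ys flip_in_signed_modes by auto
    then have "x # xs \<in> tuples ?A r" "flip x # ys \<in> tuples ?A r'"
      using r by simp_all
    then have "cmod (c (x # xs)) * cmod (c' (flip x # ys)) * W \<le> B * C * \<tau> x"
      unfolding W_def \<tau>_def zs_eq by (intro bracket_term_le B C) auto
    moreover have "cmod (of_int (snd x)) = 1" using x by (auto simp: signed_modes_def)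
    then have "cmod (- (2 * \<i> * of_nat (r * r') * of_int (snd x)) * (c (x # xs) * c' (flip x # ys))) * W =
        2 * real (r * r') * (cmod (c (x # xs)) * cmod (c' (flip x # ys)) * W)"
      by (simp add: norm_mult)
    ultimately show ?thesis by (simp only: mult_left_mono of_nat_0_le_iff mult_nonneg_nonneg zero_le_numeral)
  qed
  have "card (fst ` set zs) \<le> r + r'"
    using card_image_le[of "set zs" fst] card_length[of zs] len by simp
  then have \<tau>: "(\<Sum>x\<in>?A. \<tau> x) \<le> (4 * real (r + r') + 72) * ln M"
    unfolding \<tau>_def by (intro sum_resonance_weights_le M) auto
  have "cmod (bracket_coeff M r r' c c' zs) * W \<le>
      (\<Sum>x\<in>?A. cmod (- (2 * \<i> * of_nat (r * r') * of_int (snd x)) * (c (x # xs) * c' (flip x # ys)))) * W"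
    unfolding bracket_coeff_def xs_def[symmetric] ys_def[symmetric] by (intro mult_right_mono norm_sum W)
  also have "\<dots> \<le> (\<Sum>x\<in>?A. 2 * real (r * r') * (B * C * \<tau> x))"
    unfolding sum_distrib_right by (intro sum_mono term_le)
  also have "\<dots> = 2 * real (r * r') * (B * C) * (\<Sum>x\<in>?A. \<tau> x)"
    by (simp only: sum_distrib_left mult.assoc)
  also have "\<dots> \<le> 2 * real (r * r') * (B * C) * ((4 * real (r + r') + 72) * ln M)"
    by (rule mult_left_mono[OF \<tau> mult_nonneg_nonneg[OF _ BC]]) simp
  also have "\<dots> = 2 * real (r * r') * (4 * real (r + r') + 72) * ln M * C * B"
    by (simp only: mult_ac)
  finally show ?thesis by (simp only: W_def)
qed

theorem proposition4p4:
  fixes r r' :: nat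
  assumes "r \<ge> 2" and "r' \<ge> 2"
  shows "\<exists>c::real. c > 0 \<and>
    (\<forall>M::real. M \<ge> 2 \<longrightarrow> (\<forall>H\<in>homogeneous_polys M r'. \<forall>\<chi>\<in>homogeneous_polys M r.
       poisson_bracket M \<chi> H \<in> homogeneous_polys M (r + r' - 2) \<and>
       norm_H M (r + r' - 2) (poisson_bracket M \<chi> H) \<le> c * ln M * norm_H M r' H * norm_C M r \<chi>))"
proof (intro exI conjI allI impI ballI)
  let ?K = "2 * real (r * r') * (4 * real (r + r') + 72)"
  show "?K > 0" using assms by simp
  fix M :: real and H \<chi> assume M: "2 \<le> M"
    and H: "H \<in> homogeneous_polys M r'" and \<chi>: "\<chi> \<in> homogeneous_polys M r"
  let ?A = "signed_modes M" and ?q = "r + r' - 2"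
  define c where "c xs = poly_coeff M r \<chi> (map snd xs) (map fst xs)" for xs
  define c' where "c' xs = poly_coeff M r' H (map snd xs) (map fst xs)" for xs
  note fam = poly_coeff_family[OF \<chi>] and fam' = poly_coeff_family[OF H]
  have r: "1 \<le> r" "1 \<le> r'" using assms by auto
  define d where "d = bracket_coeff M r r' c c'"
  have bracket: "of_real (poisson_bracket M \<chi> H u) = form ?A ?q d (signed_coord u)" if "u \<in> states M" for u
    unfolding d_def c_def c'_def
    by (rule poisson_bracket_form[OF coeff_family_symmetric[OF fam] coeff_family_conj[OF fam]
          coeff_family_form[OF fam] coeff_family_symmetric[OF fam'] coeff_family_conj[OF fam']
          coeff_family_form[OF fam'] r that])
  then show "poisson_bracket M \<chi> H \<in> homogeneous_polys M ?q"
    unfolding homogeneous_polys_iff_form by blast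
  let ?B = "norm_C M r \<chi>" and ?C = "norm_H M r' H"
  have B: "cmod (c xs) * jap (of_int (phase xs)) * mode_weight xs * lone_weight xs \<le> ?B"
    if "xs \<in> tuples ?A r" for xs
    unfolding c_def by (rule coeff_le_norm_C[OF that])
  have C: "cmod (c' xs) * mode_weight xs * lone_weight xs \<le> ?C" if "xs \<in> tuples ?A r'" for xs
    unfolding c'_def by (rule coeff_le_norm_H[OF that])
  have "0 \<le> ?B"
  proof -
    have "replicate r ((0, 0), 1) \<in> tuples ?A r"
      using M by (auto simp: tuples_def signed_modes_def modes_def)
    from B[OF this] show ?thesis
      by (rule order_trans[rotated]) (simp add: jap_pos mode_weight_pos lone_weight_pos less_imp_le)
  qed
  moreover have "0 \<le> ?C"
  proof -
    have "replicate r' ((0, 0), 1) \<in> tuples ?A r'"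
      using M by (auto simp: tuples_def signed_modes_def modes_def)
    from C[OF this] show ?thesis
      by (rule order_trans[rotated]) (simp add: mode_weight_pos lone_weight_pos less_imp_le)
  qed
  ultimately have BC: "0 \<le> ?B * ?C" by simp
  show "norm_H M ?q (poisson_bracket M \<chi> H) \<le> ?K * ln M * ?C * ?B"
  proof (rule norm_H_leI)
    fix zs assume zs: "zs \<in> tuples ?A ?q"
    have "poly_coeff M ?q (poisson_bracket M \<chi> H) (map snd zs) (map fst zs) =
        symmetrize d (zip (map fst zs) (map snd zs))"
      by (rule poly_coeff_eqI[OF symmetric_on_symmetrize _ map_fst_snd_in_tuples[OF zs]])
         (simp only: form_symmetrize[OF finite_signed_modes] bracket)
    also have "zip (map fst zs) (map snd zs) = zs" by (rule zip_map_fst_snd)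
    finally have coeff: "poly_coeff M ?q (poisson_bracket M \<chi> H) (map snd zs) (map fst zs) = symmetrize d zs" .
    define W where "W = mode_weight zs * lone_weight zs"
    have W: "0 < W" by (simp add: W_def mode_weight_pos lone_weight_pos)
    \<comment> \<open>The weight \<open>W\<close> is common to all rearrangements of \<open>zs\<close>.\<close>
    have "cmod (symmetrize d zs) \<le> (?K * ln M * ?C * ?B) / W"
    proof (rule norm_symmetrize_le)
      fix ys assume ys: "mset ys = mset zs"
      then have "ys \<in> tuples ?A ?q" using zs mset_eq_tuples[OF ys] by blast
      from norm_bracket_coeff_le[OF M r B C BC this, folded d_def]
      have "cmod (d ys) * W \<le> ?K * ln M * ?C * ?B"
        unfolding W_def weights_mset_cong[OF ys] .
      then show "cmod (d ys) \<le> (?K * ln M * ?C * ?B) / W" using W by (simp only: pos_le_divide_eq)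
    qed
    then have "cmod (symmetrize d zs) * W \<le> ?K * ln M * ?C * ?B" using W by (simp only: pos_le_divide_eq)
    then show "cmod (poly_coeff M ?q (poisson_bracket M \<chi> H) (map snd zs) (map fst zs)) *
        mode_weight zs * lone_weight zs \<le> ?K * ln M * ?C * ?B"
      by (simp only: coeff W_def mult.assoc)
  qed (use M in simp)
qed

end
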